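(* Let $(X,d)$ be a compact metric space without isolated points and let $T\colon X\to X$ be a continuous map. If $T$ is not uniquely ergodic, $\mathcal{M}(X,T)=X$ and $\mathcal{P}_T^{erg}(X)$ is dense in $\mathcal{P}_T(X)$, then: (a) $\{x\in X\colon V_T(x)=\mathcal{P}_T(X)\}$ is Baire generic in $X$. (b) $\mathcal{CI}(X,T)$ is Baire generic in $X$. (c) $T$ is transitive.
   Context: $\mathcal{P}_T(X)$ is the space of $T$-invariant Borel probability measures on $X$ with the weak$^*$ topology, $\mathcal{P}_T^{erg}(X)$ its subset of ergodic measures; $T$ is uniquely ergodic if $\mathcal{P}_T(X)$ has exactly one element. The measure center of $T$ is $\mathcal{M}(X,T)=\overline{\bigcup_{\mu\in\mathcal{P}_T(X)}\operatorname{supp}\mu}$. $V_T(x)$ is the set of weak$^*$ accumulation points (limits of subsequences) of the empirical measures $\frac1n\sum_{j=0}^{n-1}\delta_{T^j(x)}$, $n\ge1$. A set is Baire generic in $X$ if it contains a countable intersection of open dense subsets of $X$. $T$ is transitive if for all nonempty open $U,V\subset X$ there is $n\in\mathbb{N}=\{1,2,\dots\}$ with $U\cap T^{-n}(V)\ne\emptyset$. For $\varphi\in C^0(X,\mathbb{R})$ (continuous real-valued functions), $\mathcal{I}(T,\varphi)$ is the set of $x\in X$ such that $\big(\frac1n\sum_{j=0}^{n-1}\varphi(T^j(x))\big)_{n\ge1}$ does not converge; $\mathcal{H}(X,T)=\{\varphi\in C^0(X,\mathbb{R})\colon\mathcal{I}(T,\varphi)\neq\emptyset\}$; and $\mathcal{CI}(X,T)=\bigcap_{\varphi\in\mathcal{H}(X,T)}\mathcal{I}(T,\varphi)$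 is the set of completely irregular points. *)

theory Defs
  imports "HOL-Probability.Probability"
begin

section \<open>Borel probability measures with the weak* topology\<close>

definition borel_prob_measures :: "'a::topological_space measure set" where
  "borel_prob_measures = {\<mu>. sets \<mu> = sets borel \<and> prob_space \<mu>}"

text \<open>The coarsest topology making \<open>\<mu> \<mapsto> \<integral>\<phi> d\<mu>\<close> continuous for every continuous real \<open>\<phi>\<close>.
  It is intended for compact \<open>'a\<close>, where continuous functions are bounded and hence integrable.\<close>

definition weak_star :: "'a::topological_space measure topology" where
  "weak_star = topology_generated_by
     {{\<mu> \<in> borel_prob_measures. (\<integral>x. \<phi> x \<partial>\<mu>) \<in> U} | (\<phi> :: 'a \<Rightarrow> real) U.
        continuous_on UNIV \<phi> \<and> open U}"

lemma topspace_weak_star: "topspace weak_star = borel_prob_measures"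
proof -
  have "borel_prob_measures \<in> {{\<mu> \<in> borel_prob_measures. (\<integral>x. \<phi> x \<partial>\<mu>) \<in> U} | (\<phi> :: 'a \<Rightarrow> real) U.
        continuous_on UNIV \<phi> \<and> open U}"
    by (intro CollectI exI[of _ "\<lambda>_. 0"] exI[of _ UNIV]) auto
  then show ?thesis
    unfolding weak_star_def topology_generated_by_topspace by blast
qed

lemma limitin_weak_star_iff:
  "limitin weak_star m \<mu> F \<longleftrightarrow>
     \<mu> \<in> borel_prob_measures \<and> (\<forall>\<^sub>F i in F. m i \<in> borel_prob_measures) \<and>
     (\<forall>\<phi> :: 'a::topological_space \<Rightarrow> real. continuous_on UNIV \<phi> \<longrightarrow>
        ((\<lambda>i. \<integral>x. \<phi> x \<partial>m i) \<longlongrightarrow> (\<integral>x. \<phi> x \<partial>\<mu>)) F)"  (is "?L \<longleftrightarrow> ?R")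
proof
  assume L: ?L
  then have mu: "\<mu> \<in> borel_prob_measures"
    by (simp add: limitin_def topspace_weak_star)
  have ev: "\<forall>\<^sub>F i in F. m i \<in> borel_prob_measures"
    using L openin_topspace[of "weak_star :: 'a measure topology"] mu
    unfolding limitin_def topspace_weak_star by blast
  moreover have "((\<lambda>i. \<integral>x. \<phi> x \<partial>m i) \<longlongrightarrow> (\<integral>x. \<phi> x \<partial>\<mu>)) F"
    if "continuous_on UNIV \<phi>" for \<phi> :: "'a \<Rightarrow> real"
  proof (rule topological_tendstoI)
    fix U assume U: "open U" "(\<integral>x. \<phi> x \<partial>\<mu>) \<in> U"
    have "openin weak_star {\<mu> \<in> borel_prob_measures. (\<integral>x. \<phi> x \<partial>\<mu>) \<in> U}"
      unfolding weak_star_def using that U by (intro topology_generated_by_Basis) auto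
    then have "\<forall>\<^sub>F i in F. m i \<in> {\<mu> \<in> borel_prob_measures. (\<integral>x. \<phi> x \<partial>\<mu>) \<in> U}"
      using L U(2) mu unfolding limitin_def by blast
    then show "\<forall>\<^sub>F i in F. (\<integral>x. \<phi> x \<partial>m i) \<in> U"
      by eventually_elim simp
  qed
  ultimately show ?R using mu by blast
next
  assume R: ?R
  have "\<forall>\<^sub>F i in F. m i \<in> W"
    if "generate_topology_on {{\<mu> \<in> borel_prob_measures. (\<integral>x. \<phi> x \<partial>\<mu>) \<in> U} | (\<phi> :: 'a \<Rightarrow> real) U.
        continuous_on UNIV \<phi> \<and> open U} W" and "\<mu> \<in> W" for W
    using that
  proof (induction rule: generate_topology_on.induct)
    case Empty
    then show ?case by simp
  next
    case (Int A B)
    then show ?case by (simp add: eventually_conj_iff)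
  next
    case (UN K)
    then obtain k where k: "k \<in> K" "\<mu> \<in> k" by blast
    from UN.IH[OF this] show ?case
      by (rule eventually_mono) (use k in blast)
  next
    case (Basis S)
    then obtain \<phi> :: "'a \<Rightarrow> real" and U
      where S: "S = {\<mu> \<in> borel_prob_measures. (\<integral>x. \<phi> x \<partial>\<mu>) \<in> U}" "continuous_on UNIV \<phi>" "open U"
      by blast
    have "\<forall>\<^sub>F i in F. (\<integral>x. \<phi> x \<partial>m i) \<in> U"
      using R S Basis.prems by (intro topological_tendstoD) auto
    moreover have "\<forall>\<^sub>F i in F. m i \<in> borel_prob_measures" using R by blast
    ultimately show ?case unfolding S(1) by eventually_elim simp
  qed
  then show ?L
    using R unfolding limitin_def topspace_weak_star
    by (auto simp: weak_star_def openin_topology_generated_by_iff)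
qed

definition measure_support :: "'a::topological_space measure \<Rightarrow> 'a set" where
  "measure_support \<mu> = {x. \<forall>U. open U \<longrightarrow> x \<in> U \<longrightarrow> emeasure \<mu> U > 0}"

section \<open>Invariant and ergodic measures\<close>

definition invariant_measures :: "('a::topological_space \<Rightarrow> 'a) \<Rightarrow> 'a measure set" where
  "invariant_measures T = {\<mu> \<in> borel_prob_measures. distr \<mu> borel T = \<mu>}"

definition ergodic_measures :: "('a::topological_space \<Rightarrow> 'a) \<Rightarrow> 'a measure set" where
  "ergodic_measures T = {\<mu> \<in> invariant_measures T.
     \<forall>A \<in> sets borel. T -` A = A \<longrightarrow> emeasure \<mu> A = 0 \<or> emeasure \<mu> A = 1}"

definition uniquely_ergodic :: "('a::topological_space \<Rightarrow> 'a) \<Rightarrow> bool" where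
  "uniquely_ergodic T \<longleftrightarrow> (\<exists>!\<mu>. \<mu> \<in> invariant_measures T)"

definition measure_center :: "('a::topological_space \<Rightarrow> 'a) \<Rightarrow> 'a set" where
  "measure_center T = closure (\<Union>\<mu>\<in>invariant_measures T. measure_support \<mu>)"

section \<open>Empirical measures\<close>

text \<open>The push-forward of the uniform distribution on \<open>{0, \<dots>, n - 1}\<close> along the orbit, i.e.
  \<open>1/n (\<delta>\<^bsub>x\<^esub> + \<dots> + \<delta>\<^bsub>T^(n-1) x\<^esub>)\<close>; see \<open>emeasure_empirical_measure\<close>.
  Only \<open>n \<ge> 1\<close> is meaningful.\<close>

definition empirical_measure ::
    "('a::topological_space \<Rightarrow> 'a) \<Rightarrow> 'a \<Rightarrow> nat \<Rightarrow> 'a measure" where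
  "empirical_measure T x n = distr (uniform_count_measure {..<n}) borel (\<lambda>j. (T ^^ j) x)"

lemma emeasure_empirical_measure:
  assumes "n \<ge> 1" "A \<in> sets borel"
  shows "emeasure (empirical_measure T x n) A =
           (\<Sum>j<n. emeasure (return borel ((T ^^ j) x)) A) / of_nat n"
proof -
  have m: "(\<lambda>j. (T ^^ j) x) \<in> measurable (uniform_count_measure {..<n}) borel"
    by (simp add: measurable_def space_uniform_count_measure sets_uniform_count_measure)
  have "emeasure (empirical_measure T x n) A =
      emeasure (uniform_count_measure {..<n}) ({j. (T ^^ j) x \<in> A} \<inter> {..<n})"
    unfolding empirical_measure_def
    by (subst emeasure_distr[OF m assms(2)])
      (simp add: space_uniform_count_measure vimage_def)
  also have "\<dots> = ennreal (card ({j. (T ^^ j) x \<in> A} \<inter> {..<n}) / card {..<n})"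
    by (intro emeasure_uniform_count_measure) auto
  also have "\<dots> = of_nat (card ({j. (T ^^ j) x \<in> A} \<inter> {..<n})) / of_nat n"
    using assms(1) by (simp add: divide_ennreal[symmetric] ennreal_of_nat_eq_real_of_nat)
  also have "of_nat (card ({j. (T ^^ j) x \<in> A} \<inter> {..<n})) =
      (\<Sum>j<n. emeasure (return borel ((T ^^ j) x)) A)"
    using assms(2) by (simp add: indicator_def sum.If_cases Int_commute)
  finally show ?thesis .
qed

text \<open>The shift by \<open>Suc\<close> makes the sequence of empirical measures start at \<open>n = 1\<close>.\<close>

definition empirical_limits :: "('a::topological_space \<Rightarrow> 'a) \<Rightarrow> 'a \<Rightarrow> 'a measure set" where
  "empirical_limits T x = {\<mu>. \<exists>r. strict_mono r \<and>
     limitin weak_star (\<lambda>k. empirical_measure T x (Suc (r k))) \<mu> sequentially}"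

section \<open>Irregular points\<close>

definition birkhoff_average :: "('a \<Rightarrow> 'a) \<Rightarrow> ('a \<Rightarrow> real) \<Rightarrow> 'a \<Rightarrow> nat \<Rightarrow> real" where
  "birkhoff_average T \<phi> x n = (1 / real n) * (\<Sum>j<n. \<phi> ((T ^^ j) x))"

definition irregular_set :: "('a \<Rightarrow> 'a) \<Rightarrow> ('a \<Rightarrow> real) \<Rightarrow> 'a set" where
  "irregular_set T \<phi> = {x. \<not> convergent (\<lambda>n. birkhoff_average T \<phi> x (Suc n))}"

definition irregular_observables ::
    "('a::topological_space \<Rightarrow> 'a) \<Rightarrow> ('a \<Rightarrow> real) set" where
  "irregular_observables T = {\<phi>. continuous_on UNIV \<phi> \<and> irregular_set T \<phi> \<noteq> {}}"

definition completely_irregular :: "('a::topological_space \<Rightarrow> 'a) \<Rightarrow> 'a set" where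
  "completely_irregular T = (\<Inter>\<phi>\<in>irregular_observables T. irregular_set T \<phi>)"

section \<open>Genericity and transitivity\<close>

definition baire_generic :: "'a::topological_space set \<Rightarrow> bool" where
  "baire_generic S \<longleftrightarrow>
     (\<exists>\<G>. countable \<G> \<and> (\<forall>G\<in>\<G>. open G \<and> closure G = UNIV) \<and> \<Inter>\<G> \<subseteq> S)"

definition transitive_map :: "('a::topological_space \<Rightarrow> 'a) \<Rightarrow> bool" where
  "transitive_map T \<longleftrightarrow>
     (\<forall>U V. open U \<and> open V \<and> U \<noteq> {} \<and> V \<noteq> {} \<longrightarrow> (\<exists>n\<ge>1. U \<inter> (T ^^ n) -` V \<noteq> {}))"

end

theory Submission
  imports Defs
begin

text \<open>Three facts carry the proof.

  First, an orbit segment can be made to imitate any invariant measure from inside any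
  prescribed open set (\<open>orbit_average_approximation\<close>). Given an invariant \<open>\<nu>\<close> and a nonempty open
  \<open>W\<close>, the measure center provides an invariant \<open>\<mu>\<close> that charges \<open>W\<close>. The measure
  \<open>(1 - t) \<nu> + t \<mu>\<close> is close to \<open>\<nu>\<close> for small \<open>t\<close> and still charges \<open>W\<close>; both properties are weak*
  open, so an ergodic \<open>\<eta>\<close> has them as well. By the ergodic theorem \<open>\<eta>\<close>-almost every point is
  generic for \<open>\<eta>\<close>, and since \<open>\<eta>\<close> charges \<open>W\<close> some such point lies in \<open>W\<close>: its long empirical
  measures are close to \<open>\<eta>\<close>, hence to \<open>\<nu>\<close>.

  Second, closeness of an empirical measure to \<open>\<nu>\<close> need only be tested against a countable
  uniformly dense set of continuous functions (\<open>countable_uniformly_dense_continuous\<close>). The sets of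
  points having a late empirical measure that satisfies finitely many such tests with rational data
  are open, and dense by the first fact; a point in all of these countably many sets
  accumulates at every invariant measure. As every accumulation point is invariant, this is (a).

  Third, Borel probability measures on a compact metric space are weak* compact
  (\<open>borel_prob_measures_cluster\<close>), by Tychonoff's theorem and the Riesz representation theorem. So if
  all invariant measures give \<open>\<phi>\<close> the same integral, the averages of \<open>\<phi>\<close> converge at every point,
  and \<open>\<phi>\<close> has no irregular point. Contrapositively, an observable with an irregular point
  separates two invariant measures, and its averages oscillate at every point satisfying (a); this
  is (b). Finally, (c) is the first fact for a \<open>\<nu>\<close> that charges the target set: a long orbit segment
  which starts in \<open>U\<close> and imitates \<open>\<nu>\<close> has to visit \<open>V\<close>.\<close>

section \<open>The Riesz representation theorem on compact metric spaces\<close>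

text \<open>The representing measure is obtained by Daniell's method: countable covers of a set by nonnegative
  continuous functions play the role that covers by intervals play for Lebesgue measure, with \<open>L f\<close> as
  the size of \<open>f\<close>.\<close>

locale mean_functional =
  fixes L :: "('a::metric_space \<Rightarrow> real) \<Rightarrow> real"
  assumes compact_UNIV: "compact (UNIV :: 'a set)"
    and L_add: "\<And>f g. continuous_on UNIV f \<Longrightarrow> continuous_on UNIV g \<Longrightarrow>
      L (\<lambda>x. f x + g x) = L f + L g"
    and L_scale: "\<And>f c. continuous_on UNIV f \<Longrightarrow> L (\<lambda>x. c * f x) = c * L f"
    and L_nonneg: "\<And>f. continuous_on UNIV f \<Longrightarrow> (\<And>x. 0 \<le> f x) \<Longrightarrow> 0 \<le> L f"
    and L_one: "L (\<lambda>_. 1) = 1"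
begin

lemma L_zero: "L (\<lambda>_. 0) = 0"
  using L_scale[of "\<lambda>_. 1" 0] by simp

lemma L_const: "L (\<lambda>_. c) = c"
  using L_scale[of "\<lambda>_. 1" c] L_one by simp

lemma L_diff:
  assumes "continuous_on UNIV f" "continuous_on UNIV g"
  shows "L (\<lambda>x. f x - g x) = L f - L g"
  using L_add[of f "\<lambda>x. (-1) * g x"] L_scale[of g "-1"] assms by (simp add: continuous_intros)

lemma L_mono:
  assumes "continuous_on UNIV f" "continuous_on UNIV g" "\<And>x. f x \<le> g x"
  shows "L f \<le> L g"
  using L_nonneg[of "\<lambda>x. g x - f x"] assms L_diff[of g f] by (simp add: continuous_intros)

lemma L_sum:
  assumes "\<And>i. i \<in> I \<Longrightarrow> continuous_on UNIV (f i)"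
  shows "L (\<lambda>x. \<Sum>i\<in>I. f i x) = (\<Sum>i\<in>I. L (f i))"
proof (cases "finite I")
  case True
  then show ?thesis using assms
    by (induction) (simp_all add: L_zero L_add continuous_intros)
qed (simp add: L_zero)

definition covers :: "'a set \<Rightarrow> (nat \<Rightarrow> 'a \<Rightarrow> real) set" where
  "covers A = {f. (\<forall>n. continuous_on UNIV (f n)) \<and> (\<forall>n x. 0 \<le> f n x) \<and>
                  (\<forall>x\<in>A. 1 \<le> (\<Sum>n. ennreal (f n x)))}"

definition outer :: "'a set \<Rightarrow> ennreal" where
  "outer A = (INF f\<in>covers A. \<Sum>n. ennreal (L (f n)))"

lemma outer_le: "f \<in> covers A \<Longrightarrow> outer A \<le> (\<Sum>n. ennreal (L (f n)))"
  unfolding outer_def by (rule INF_lower)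

lemma outer_le_single:
  assumes "continuous_on UNIV f" "\<And>x. 0 \<le> f x" "\<And>x. x \<in> A \<Longrightarrow> 1 \<le> f x"
  shows "outer A \<le> ennreal (L f)"
proof -
  define g where "g = (\<lambda>n::nat. if n = 0 then f else (\<lambda>_. 0))"
  have single: "(\<Sum>n. h n) = h 0" if "\<And>n. n \<noteq> 0 \<Longrightarrow> h n = 0" for h :: "nat \<Rightarrow> ennreal"
    using suminf_finite[of "{0}" h] that by simp
  have "(\<Sum>n. ennreal (g n x)) = ennreal (f x)" for x
    by (subst single) (auto simp: g_def)
  then have "g \<in> covers A"
    using assms unfolding covers_def by (auto simp: g_def)
  then have "outer A \<le> (\<Sum>n. ennreal (L (g n)))" by (rule outer_le)
  also have "\<dots> = ennreal (L f)"
    by (subst single) (auto simp: g_def L_zero)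
  finally show ?thesis .
qed

lemma outer_empty: "outer {} = 0"
  using outer_le_single[of "\<lambda>_. 0" "{}"] by (simp add: L_zero)

lemma outer_mono: "A \<subseteq> B \<Longrightarrow> outer A \<le> outer B"
  unfolding outer_def by (rule INF_superset_mono) (auto simp: covers_def)

text \<open>Doubly indexed covers serve twice: for countable subadditivity, and for splitting each member of a
  cover into countably many pieces.\<close>

lemma outer_le_double_cover:
  assumes "\<And>i k. continuous_on UNIV (f i k)" "\<And>i k x. 0 \<le> f i k x"
    and "\<And>x. x \<in> A \<Longrightarrow> 1 \<le> (\<Sum>i. \<Sum>k. ennreal (f i k x))"
  shows "outer A \<le> (\<Sum>i. \<Sum>k. ennreal (L (f i k)))"
proof -
  define g where "g = (\<lambda>n. case_prod f (prod_decode n))"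
  have "(\<Sum>n. ennreal (g n x)) = (\<Sum>i. \<Sum>k. ennreal (f i k x))" for x
    unfolding g_def by (rule suminf_ennreal_2dimen[where f = "\<lambda>p. ennreal (case_prod f p x)"]) simp
  then have "g \<in> covers A"
    using assms by (auto simp: covers_def g_def split: prod.split)
  then have "outer A \<le> (\<Sum>n. ennreal (L (g n)))" by (rule outer_le)
  also have "\<dots> = (\<Sum>i. \<Sum>k. ennreal (L (f i k)))"
    unfolding g_def by (rule suminf_ennreal_2dimen[where f = "\<lambda>p. ennreal (L (case_prod f p))"]) simp
  finally show ?thesis .
qed

lemma outer_countably_subadditive: "outer (\<Union>i. A i) \<le> (\<Sum>i. outer (A i))"
proof (rule ennreal_le_epsilon)
  fix e :: real
  assume fin: "(\<Sum>i. outer (A i)) < top" and e: "0 < e"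
  have "\<exists>f\<in>covers (A i). (\<Sum>n. ennreal (L (f n))) < outer (A i) + ennreal e * ennreal ((1/2) ^ Suc i)"
    for i
  proof -
    have "outer (A i) < top" using fin ennreal_suminf_lessD by blast
    moreover have "0 < ennreal e * ennreal ((1/2) ^ Suc i)"
      using e by (simp add: ennreal_zero_less_mult_iff)
    ultimately have "outer (A i) < outer (A i) + ennreal e * ennreal ((1/2) ^ Suc i)"
      by (simp add: less_top ennreal_add_left_cancel_less)
    then show ?thesis unfolding outer_def[of "A i"] by (simp only: INF_less_iff)
  qed
  then obtain f where f: "\<And>i. f i \<in> covers (A i)"
    and f_le: "\<And>i. (\<Sum>n. ennreal (L (f i n))) < outer (A i) + ennreal e * ennreal ((1/2) ^ Suc i)"
    by metis
  have "outer (\<Union>i. A i) \<le> (\<Sum>i. \<Sum>k. ennreal (L (f i k)))"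
  proof (rule outer_le_double_cover)
    fix x assume "x \<in> (\<Union>i. A i)"
    then obtain i where "x \<in> A i" by blast
    then have "1 \<le> (\<Sum>k. ennreal (f i k x))" using f[of i] by (auto simp: covers_def)
    also have "\<dots> \<le> (\<Sum>i. \<Sum>k. ennreal (f i k x))"
      using sum_le_suminf[OF summableI, of "{i}" "\<lambda>i. \<Sum>k. ennreal (f i k x)"] by simp
    finally show "1 \<le> (\<Sum>i. \<Sum>k. ennreal (f i k x))" .
  qed (use f in \<open>auto simp: covers_def\<close>)
  also have "\<dots> \<le> (\<Sum>i. outer (A i) + ennreal e * ennreal ((1/2) ^ Suc i))"
    by (intro suminf_le less_imp_le f_le summableI)
  also have "\<dots> = (\<Sum>i. outer (A i)) + (\<Sum>i. ennreal e * ennreal ((1/2) ^ Suc i))"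
    by (subst suminf_add[symmetric]) auto
  also have "(\<Sum>i. ennreal e * ennreal ((1/2) ^ Suc i)) = ennreal e"
    unfolding ennreal_suminf_cmult
    by (subst suminf_ennreal_eq[OF zero_le_power power_half_series]) auto
  finally show "outer (\<Union>i. A i) \<le> (\<Sum>i. outer (A i)) + ennreal e" .
qed

lemma outer_measure_space_outer: "outer_measure_space UNIV outer"
  unfolding outer_measure_space_def positive_def increasing_def countably_subadditive_def
  by (auto simp: outer_empty outer_mono outer_countably_subadditive)

text \<open>A cover \<open>f\<close> of \<open>A\<close> is split by cutoff functions \<open>h k\<close> that vanish on \<open>C\<close> and increase to \<open>1\<close> off \<open>C\<close>.
  For every \<open>k\<close> the functions \<open>f n * (1 - h k)\<close> cover \<open>C \<inter> A\<close>. The complementary parts \<open>f n * h k\<close> cover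
  \<open>- C \<inter> A\<close> only in the limit, which is why they are resolved into the increments
  \<open>f n * (h (k + 1) - h k)\<close>.\<close>

lemma outer_split_closed:
  assumes "closed C"
  shows "outer (C \<inter> A) + outer (- C \<inter> A) \<le> outer A"
proof (cases "C = {}")
  case True
  then show ?thesis by (simp add: outer_empty)
next
  case False
  define h where "h = (\<lambda>k::nat. \<lambda>x. min 1 (real k * infdist x C))"
  have h_cont: "continuous_on UNIV (h k)" for k
    unfolding h_def by (intro continuous_intros)
  have h_bounds: "0 \<le> h k x" "h k x \<le> 1" for k x
    by (auto simp: h_def infdist_nonneg)
  have h_mono: "h k x \<le> h (Suc k) x" for k x
    unfolding h_def by (intro min.mono mult_right_mono) (auto simp: infdist_nonneg)
  have h_lim: "(\<lambda>k. h k x) \<longlonglongrightarrow> 1" if "x \<notin> C" for x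
  proof (rule tendsto_eventually)
    have "0 < infdist x C"
      using that in_closed_iff_infdist_zero[OF assms False, of x] infdist_nonneg[of x C] by linarith
    then obtain K :: nat where K: "1 / infdist x C < real K"
      using reals_Archimedean2 by blast
    show "\<forall>\<^sub>F k in sequentially. h k x = 1"
      using eventually_ge_at_top[of K]
    proof eventually_elim
      case (elim k)
      then have "1 / infdist x C \<le> real k" using K by linarith
      then show ?case using \<open>0 < infdist x C\<close> by (simp add: h_def field_simps)
    qed
  qed
  show ?thesis
    unfolding outer_def[of A]
  proof (rule INF_greatest)
    fix f assume f: "f \<in> covers A"
    then have f_cont: "\<And>n. continuous_on UNIV (f n)" and f0: "\<And>n x. 0 \<le> f n x"
      and f_cov: "\<And>x. x \<in> A \<Longrightarrow> 1 \<le> (\<Sum>n. ennreal (f n x))"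
      by (auto simp: covers_def)
    define s where "s = (\<lambda>n k. L (\<lambda>x. f n x * h k x))"
    have prod_cont: "continuous_on UNIV (\<lambda>x. f n x * h k x)" for n k
      using f_cont h_cont by (intro continuous_intros) auto
    have s0: "0 \<le> s n k" for n k
      unfolding s_def using prod_cont f0 h_bounds by (intro L_nonneg) auto
    have s_mono: "s n k \<le> s n (Suc k)" for n k
      unfolding s_def using prod_cont f0 h_mono by (intro L_mono) (auto intro: mult_left_mono)
    have outside: "outer (- C \<inter> A) \<le> (SUP k. \<Sum>n. ennreal (s n k))"
    proof -
      have "outer (- C \<inter> A) \<le> (\<Sum>n. \<Sum>k. ennreal (L (\<lambda>x. f n x * (h (Suc k) x - h k x))))"
      proof (rule outer_le_double_cover)
        show "continuous_on UNIV (\<lambda>x. f n x * (h (Suc k) x - h k x))" for n k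
          using f_cont h_cont by (intro continuous_intros) auto
        show "0 \<le> f n x * (h (Suc k) x - h k x)" for n k x
          using f0 h_mono by (intro mult_nonneg_nonneg) auto
        fix x assume x: "x \<in> - C \<inter> A"
        have "(\<lambda>k. h (Suc k) x - h k x) sums (1 - h 0 x)"
          using x by (intro telescope_sums h_lim) auto
        then have "(\<lambda>k. h (Suc k) x - h k x) sums 1" by (simp add: h_def)
        then have "(\<Sum>k. ennreal (h (Suc k) x - h k x)) = 1"
          using h_mono by (subst suminf_ennreal_eq) auto
        then have "(\<Sum>k. ennreal (f n x * (h (Suc k) x - h k x))) = ennreal (f n x)" for n
          using f0 h_mono by (simp add: ennreal_mult)
        then show "1 \<le> (\<Sum>n. \<Sum>k. ennreal (f n x * (h (Suc k) x - h k x)))"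
          using f_cov x by simp
      qed
      also have "\<dots> = (\<Sum>n. SUP k. ennreal (s n k))"
      proof (rule suminf_cong)
        fix n
        have "(\<Sum>k. ennreal (L (\<lambda>x. f n x * (h (Suc k) x - h k x))))
            = (\<Sum>k. ennreal (s n (Suc k) - s n k))"
          unfolding s_def by (simp add: right_diff_distrib L_diff prod_cont)
        also have "\<dots> = (SUP k. \<Sum>i<k. ennreal (s n (Suc i) - s n i))"
          by (rule suminf_eq_SUP)
        also have "\<dots> = (SUP k. ennreal (s n k))"
        proof (rule SUP_cong)
          fix k
          have "s n 0 = 0" by (simp add: s_def h_def L_zero)
          then show "(\<Sum>i<k. ennreal (s n (Suc i) - s n i)) = ennreal (s n k)"
            using s_mono by (subst sum_ennreal) (auto simp: sum_lessThan_telescope)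
        qed simp
        finally show "(\<Sum>k. ennreal (L (\<lambda>x. f n x * (h (Suc k) x - h k x)))) = (SUP k. ennreal (s n k))" .
      qed
      also have "\<dots> = (SUP k. \<Sum>n. ennreal (s n k))"
        using s_mono by (intro ennreal_suminf_SUP_eq incseq_SucI ennreal_leI)
      finally show ?thesis .
    qed
    have inside: "outer (C \<inter> A) + (\<Sum>n. ennreal (s n k)) \<le> (\<Sum>n. ennreal (L (f n)))" for k
    proof -
      have cont: "continuous_on UNIV (\<lambda>x. f n x * (1 - h k x))" for n
        using f_cont h_cont by (intro continuous_intros) auto
      have nonneg: "0 \<le> f n x * (1 - h k x)" for n x
        using f0 h_bounds by (intro mult_nonneg_nonneg) auto
      have "h k x = 0" if "x \<in> C" for x
        using that by (simp add: h_def)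
      then have "(\<lambda>n x. f n x * (1 - h k x)) \<in> covers (C \<inter> A)"
        unfolding covers_def using cont nonneg f_cov by auto
      then have "outer (C \<inter> A) \<le> (\<Sum>n. ennreal (L (\<lambda>x. f n x * (1 - h k x))))"
        by (rule outer_le)
      then have "outer (C \<inter> A) + (\<Sum>n. ennreal (s n k))
          \<le> (\<Sum>n. ennreal (L (\<lambda>x. f n x * (1 - h k x)))) + (\<Sum>n. ennreal (s n k))"
        by (rule add_right_mono)
      also have "\<dots> = (\<Sum>n. ennreal (L (\<lambda>x. f n x * (1 - h k x))) + ennreal (s n k))"
        by (rule suminf_add) auto
      also have "\<dots> = (\<Sum>n. ennreal (L (f n)))"
      proof (rule suminf_cong)
        fix n
        have "L (\<lambda>x. f n x * (1 - h k x) + f n x * h k x) = L (\<lambda>x. f n x * (1 - h k x)) + s n k"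
          unfolding s_def by (rule L_add[OF cont prod_cont])
        then have "L (\<lambda>x. f n x * (1 - h k x)) + s n k = L (f n)"
          by (simp add: algebra_simps)
        then show "ennreal (L (\<lambda>x. f n x * (1 - h k x))) + ennreal (s n k) = ennreal (L (f n))"
          using s0 L_nonneg[OF cont nonneg] by (simp flip: ennreal_plus)
      qed
      finally show ?thesis .
    qed
    have "outer (C \<inter> A) + outer (- C \<inter> A) \<le> outer (C \<inter> A) + (SUP k. \<Sum>n. ennreal (s n k))"
      using outside by (rule add_left_mono)
    also have "\<dots> = (SUP k. outer (C \<inter> A) + (\<Sum>n. ennreal (s n k)))"
      by (rule ennreal_SUP_add_right) simp
    also have "\<dots> \<le> (\<Sum>n. ennreal (L (f n)))"
      using inside by (rule SUP_least)
    finally show "outer (C \<inter> A) + outer (- C \<inter> A) \<le> (\<Sum>n. ennreal (L (f n)))" .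
  qed
qed

text \<open>By Caratheodory's construction it is enough that closed sets split every set, as they generate the
  Borel sets.\<close>

lemma measure_space_outer: "measure_space UNIV (sets borel) outer"
proof -
  interpret P: sigma_algebra "UNIV :: 'a set" UNIV
    using sigma_algebra_Pow[of "UNIV :: 'a set"] by simp
  have lambda: "measure_space UNIV (lambda_system UNIV UNIV outer) outer"
    by (rule P.caratheodory_lemma[OF outer_measure_space_outer])
  then interpret sigma_algebra "UNIV :: 'a set" "lambda_system UNIV UNIV outer"
    by (simp add: measure_space_def)
  have "C \<in> lambda_system UNIV UNIV outer" if "closed C" for C
  proof -
    have "outer (C \<inter> A) + outer (- C \<inter> A) = outer A" for A
    proof (rule antisym[OF outer_split_closed[OF that]])
      have "subadditive UNIV outer"
        using outer_measure_space_outer P.countably_subadditive_subadditive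
        by (auto simp: outer_measure_space_def)
      then have "outer ((C \<inter> A) \<union> (- C \<inter> A)) \<le> outer (C \<inter> A) + outer (- C \<inter> A)"
        by (rule subadditiveD) auto
      then show "outer A \<le> outer (C \<inter> A) + outer (- C \<inter> A)"
        by (simp flip: Int_Un_distrib2)
    qed
    then show ?thesis by (simp add: lambda_system_def flip: Compl_eq_Diff_UNIV)
  qed
  then have "sigma_sets UNIV (Collect closed) \<subseteq> lambda_system UNIV UNIV outer"
    by (intro sigma_sets_subset) auto
  then have "sets (borel :: 'a measure) \<subseteq> lambda_system UNIV UNIV outer"
    by (simp add: borel_eq_closed)
  then show ?thesis
    using measure_down[OF lambda] sets.sigma_algebra_axioms[of "borel :: 'a measure"] by simp
qed

definition representing_measure :: "'a measure" where
  "representing_measure = measure_of UNIV (sets borel) outer"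

lemma sets_representing_measure [simp, measurable_cong]: "sets representing_measure = sets borel"
  unfolding representing_measure_def using sets.sets_measure_of_eq[of "borel :: 'a measure"] by simp

lemma space_representing_measure [simp]: "space representing_measure = UNIV"
  by (simp add: representing_measure_def space_measure_of_conv)

lemma emeasure_representing_measure: "A \<in> sets borel \<Longrightarrow> emeasure representing_measure A = outer A"
  using measure_space_outer unfolding representing_measure_def measure_space_def
  by (intro emeasure_measure_of_sigma) auto

text \<open>Compactness enters here, as in Dini's theorem: a countable cover of the whole space has a
  finite partial sum above any \<open>c < 1\<close>.\<close>

lemma outer_UNIV: "outer UNIV = 1"
proof (rule antisym)
  show "outer UNIV \<le> 1" using outer_le_single[of "\<lambda>_. 1" UNIV] by (simp add: L_one)
  show "1 \<le> outer UNIV"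
    unfolding outer_def
  proof (intro INF_greatest)
    fix f assume f: "f \<in> covers UNIV"
    then have f_cont: "\<And>n. continuous_on UNIV (f n)" and f0: "\<And>n x. 0 \<le> f n x"
      and f_cov: "\<And>x. 1 \<le> (\<Sum>n. ennreal (f n x))"
      by (auto simp: covers_def)
    have "ennreal c \<le> (\<Sum>n. ennreal (L (f n)))" if c: "c < 1" for c :: real
    proof -
      define U where "U N = {x. c < (\<Sum>n<N. f n x)}" for N
      have "open (U N)" for N
        unfolding U_def using f_cont by (intro open_Collect_less continuous_intros) auto
      moreover have "UNIV \<subseteq> (\<Union>N. U N)"
      proof
        fix x
        have "ennreal c < 1" using c by (simp add: ennreal_less_one_iff)
        also have "\<dots> \<le> (SUP N. \<Sum>n<N. ennreal (f n x))"
          using f_cov[of x] by (simp add: suminf_eq_SUP)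
        finally obtain N where "ennreal c < (\<Sum>n<N. ennreal (f n x))"
          by (auto simp: less_SUP_iff)
        then have "c < (\<Sum>n<N. f n x)"
          using f0 by (simp add: sum_ennreal ennreal_less_iff sum_nonneg)
            (meson ennreal_leI leD le_less_linear)
        then show "x \<in> (\<Union>N. U N)" by (auto simp: U_def)
      qed
      ultimately obtain I where I: "finite I" "UNIV \<subseteq> (\<Union>N\<in>I. U N)"
        using compactE_image[OF compact_UNIV, of UNIV U] by metis
      define N where "N = Max (insert 0 I)"
      have "c \<le> (\<Sum>n<N. f n x)" for x
      proof -
        obtain M where "M \<in> I" "x \<in> U M" using I by blast
        then have "c < (\<Sum>n<M. f n x)" by (simp add: U_def)
        also have "\<dots> \<le> (\<Sum>n<N. f n x)"
          using \<open>M \<in> I\<close> I(1) f0 by (intro sum_mono2) (auto simp: N_def less_max_iff_disj Max_ge less_le_trans)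
        finally show ?thesis by simp
      qed
      then have "L (\<lambda>_. c) \<le> L (\<lambda>x. \<Sum>n<N. f n x)"
        using f_cont by (intro L_mono continuous_intros) auto
      then have "c \<le> (\<Sum>n<N. L (f n))"
        using f_cont by (simp add: L_const L_sum)
      then have "ennreal c \<le> (\<Sum>n<N. ennreal (L (f n)))"
        using f_cont f0 L_nonneg by (subst sum_ennreal) (auto intro: ennreal_leI)
      also have "\<dots> \<le> (\<Sum>n. ennreal (L (f n)))"
        by (intro sum_le_suminf) auto
      finally show ?thesis .
    qed
    note below = this
    show "1 \<le> (\<Sum>n. ennreal (L (f n)))"
    proof (rule dense_le)
      fix z :: ennreal assume z: "z < 1"
      then obtain c where "z = ennreal c" "0 \<le> c" by (cases z) auto
      with z below[of c] show "z \<le> (\<Sum>n. ennreal (L (f n)))"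
        by (simp add: ennreal_less_one_iff)
    qed
  qed
qed

lemma prob_space_representing_measure: "prob_space representing_measure"
  by (rule prob_spaceI) (simp add: emeasure_representing_measure outer_UNIV)

text \<open>Layer cake: \<open>f\<close> is cut at the heights \<open>i / N\<close>. The slice between two consecutive heights is at most
  \<open>1 / N\<close> and lives where \<open>f\<close> exceeds the lower height, while \<open>N\<close> times the slice covers the set where
  \<open>f\<close> exceeds the upper one. Comparing the two bounds costs a shift of the index by one, that is, \<open>1 / N\<close>.\<close>

lemma integral_representing_measure_le:
  assumes cont: "continuous_on UNIV f" and bounds: "\<And>x. 0 \<le> f x" "\<And>x. f x \<le> 1"
  shows "(\<integral>x. f x \<partial>representing_measure) \<le> L f"
proof -
  interpret prob_space representing_measure by (rule prob_space_representing_measure)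
  have meas: "g \<in> borel_measurable representing_measure" if "continuous_on UNIV g" for g :: "'a \<Rightarrow> real"
    using borel_measurable_continuous_onI[OF that] by (simp cong: measurable_cong_sets)
  have approx: "(\<integral>x. f x \<partial>representing_measure) \<le> L f + 1 / real N" if N: "N > 0" for N :: nat
  proof -
    define c where "c = (\<lambda>i::nat. \<lambda>x. min (f x) (real i / real N))"
    define m where "m = (\<lambda>i::nat. measure representing_measure {x. real i / real N \<le> f x})"
    have level: "{x. t \<le> f x} \<in> sets borel" for t :: real
      by (intro borel_closed closed_Collect_le continuous_intros cont)
    have c_cont: "continuous_on UNIV (c i)" for i
      unfolding c_def using cont by (intro continuous_intros)
    have c_mono: "c i x \<le> c (Suc i) x" for i x
      unfolding c_def by (intro min.mono divide_right_mono) auto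
    have c_bounded: "\<bar>c i x\<bar> \<le> 1" for i x
      using bounds[of x] by (auto simp: c_def)
    have c_int: "integrable representing_measure (c i)" for i
      using c_bounded by (intro integrable_const_bound[where B = 1] meas c_cont) auto
    have f_eq: "f x = (\<Sum>i<N. c (Suc i) x - c i x)" for x
      unfolding sum_lessThan_telescope[of "\<lambda>i. c i x"] using bounds[of x] N by (simp add: c_def)
    have upper: "(\<integral>x. c (Suc i) x - c i x \<partial>representing_measure) \<le> m i / real N" for i
    proof -
      have "(\<integral>x. c (Suc i) x - c i x \<partial>representing_measure)
          \<le> (\<integral>x. 1 / real N * indicator {x. real i / real N \<le> f x} x \<partial>representing_measure)"
      proof (rule integral_mono)
        show "integrable representing_measure (\<lambda>x. c (Suc i) x - c i x)"
          using c_int by (intro Bochner_Integration.integrable_diff)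
        show "integrable representing_measure (\<lambda>x. 1 / real N * indicator {x. real i / real N \<le> f x} x)"
          using level by (intro integrable_mult_right integrable_real_indicator)
            (auto simp: emeasure_eq_measure)
        show "c (Suc i) x - c i x \<le> 1 / real N * indicator {x. real i / real N \<le> f x} x" for x
          by (auto simp: c_def indicator_def add_divide_distrib min_def)
      qed
      also have "\<dots> = m i / real N"
        using level by (simp add: m_def)
      finally show ?thesis .
    qed
    have lower: "m (Suc i) / real N \<le> L (\<lambda>x. c (Suc i) x - c i x)" for i
    proof -
      have cont_i: "continuous_on UNIV (\<lambda>x. c (Suc i) x - c i x)"
        using c_cont by (intro continuous_intros)
      have "ennreal (m (Suc i)) = outer {x. real (Suc i) / real N \<le> f x}"
        using level by (simp add: m_def emeasure_representing_measure flip: emeasure_eq_measure)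
      also have "\<dots> \<le> ennreal (L (\<lambda>x. real N * (c (Suc i) x - c i x)))"
      proof (rule outer_le_single)
        show "continuous_on UNIV (\<lambda>x. real N * (c (Suc i) x - c i x))"
          by (intro continuous_intros c_cont)
        show "0 \<le> real N * (c (Suc i) x - c i x)" for x
          using c_mono by simp
        fix x assume "x \<in> {x. real (Suc i) / real N \<le> f x}"
        then have "real (Suc i) / real N \<le> f x" by simp
        moreover have "real i / real N \<le> real (Suc i) / real N" by (simp add: divide_right_mono)
        ultimately have "c (Suc i) x = real (Suc i) / real N" "c i x = real i / real N"
          unfolding c_def by linarith+
        then have "c (Suc i) x - c i x = 1 / real N"
          by (simp add: add_divide_distrib)
        then show "1 \<le> real N * (c (Suc i) x - c i x)" using N by simp
      qed
      also have "\<dots> = ennreal (real N * L (\<lambda>x. c (Suc i) x - c i x))"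
        using cont_i by (simp add: L_scale)
      finally have "m (Suc i) \<le> real N * L (\<lambda>x. c (Suc i) x - c i x)"
        using cont_i c_mono L_nonneg by (subst (asm) ennreal_le_iff) auto
      then show ?thesis using N by (simp add: field_simps)
    qed
    have "(\<integral>x. f x \<partial>representing_measure) = (\<Sum>i<N. \<integral>x. c (Suc i) x - c i x \<partial>representing_measure)"
      unfolding f_eq using c_int by (intro Bochner_Integration.integral_sum) auto
    also have "\<dots> \<le> (\<Sum>i<N. m i / real N)"
      by (intro sum_mono upper)
    also have "\<dots> = (\<Sum>i<N. m (Suc i) / real N) + (m 0 - m N) / real N"
      using sum_lessThan_telescope'[of "\<lambda>i. m i / real N" N]
      by (simp add: sum_subtractf diff_divide_distrib)
    also have "\<dots> \<le> (\<Sum>i<N. L (\<lambda>x. c (Suc i) x - c i x)) + 1 / real N"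
    proof (intro add_mono sum_mono lower divide_right_mono)
      have "m 0 \<le> 1" "0 \<le> m N" by (simp_all add: m_def)
      then show "m 0 - m N \<le> 1" by linarith
    qed simp
    also have "(\<Sum>i<N. L (\<lambda>x. c (Suc i) x - c i x)) = L f"
      using c_cont by (subst f_eq[abs_def], subst L_sum) (auto intro!: continuous_intros)
    finally show ?thesis .
  qed
  have "(\<lambda>n. L f + 1 / real (Suc n)) \<longlonglongrightarrow> L f + 0"
    by (intro tendsto_intros LIMSEQ_Suc lim_1_over_n)
  then have "(\<lambda>n. L f + 1 / real (Suc n)) \<longlonglongrightarrow> L f" by (simp only: add_0_right)
  then show ?thesis
    by (rule LIMSEQ_le_const) (use approx[OF zero_less_Suc] in blast)
qed

text \<open>Total mass \<open>1\<close> turns the inequality into an equality, by applying it to \<open>g\<close> and to \<open>1 - g\<close>; an affine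
  change brings every continuous function into the range \<open>[0, 1]\<close>.\<close>

lemma integral_representing_measure:
  assumes cont: "continuous_on UNIV f"
  shows "(\<integral>x. f x \<partial>representing_measure) = L f"
proof -
  interpret prob_space representing_measure by (rule prob_space_representing_measure)
  obtain B where B: "B > 0" "\<And>x. \<bar>f x\<bar> \<le> B"
    using compact_imp_bounded[OF compact_continuous_image[OF cont compact_UNIV]]
    by (auto simp: bounded_pos)
  define g where "g = (\<lambda>x. (f x + B) / (2 * B))"
  have g_cont: "continuous_on UNIV g"
    unfolding g_def using B cont by (intro continuous_intros) auto
  have g_bounds: "0 \<le> g x" "g x \<le> 1" for x
    using B(1) B(2)[of x] by (auto simp: g_def field_simps)
  have meas: "g \<in> borel_measurable representing_measure"
    using borel_measurable_continuous_onI[OF g_cont] by (simp cong: measurable_cong_sets)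
  have g_int: "integrable representing_measure g"
    using g_bounds by (intro integrable_const_bound[where B = 1] meas) auto
  have "(\<integral>x. 1 - g x \<partial>representing_measure) \<le> L (\<lambda>x. 1 - g x)"
    using g_bounds g_cont by (intro integral_representing_measure_le continuous_intros) auto
  then have "(\<integral>x. g x \<partial>representing_measure) \<ge> L g"
    using g_int g_cont prob_space by (simp add: L_diff L_one)
  with integral_representing_measure_le[OF g_cont g_bounds] have eq: "(\<integral>x. g x \<partial>representing_measure) = L g" by simp
  have f_eq: "f = (\<lambda>x. 2 * B * g x + - B)"
    using B(1) by (auto simp: g_def)
  have "(\<integral>x. f x \<partial>representing_measure) = 2 * B * (\<integral>x. g x \<partial>representing_measure) - B"
    using g_int prob_space by (subst f_eq) simp
  also have "\<dots> = L f"
    using g_cont eq by (subst f_eq, subst L_add) (auto simp: L_scale L_const intro!: continuous_intros)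
  finally show ?thesis .
qed

end

theorem riesz_representation_compact:
  fixes L :: "('a::metric_space \<Rightarrow> real) \<Rightarrow> real"
  assumes "compact (UNIV :: 'a set)"
    and "\<And>f g. continuous_on UNIV f \<Longrightarrow> continuous_on UNIV g \<Longrightarrow> L (\<lambda>x. f x + g x) = L f + L g"
    and "\<And>f c. continuous_on UNIV f \<Longrightarrow> L (\<lambda>x. c * f x) = c * L f"
    and "\<And>f. continuous_on UNIV f \<Longrightarrow> (\<And>x. 0 \<le> f x) \<Longrightarrow> 0 \<le> L f"
    and "L (\<lambda>_. 1) = 1"
  obtains \<mu> where "\<mu> \<in> borel_prob_measures"
    and "\<And>f. continuous_on UNIV f \<Longrightarrow> (\<integral>x. f x \<partial>\<mu>) = L f"
proof -
  interpret mean_functional L using assms by unfold_locales auto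
  show thesis
    using that[of representing_measure] prob_space_representing_measure integral_representing_measure by (simp add: borel_prob_measures_def)
qed

section \<open>Borel probability measures on compact metric spaces\<close>

lemma borel_prob_measuresD:
  assumes "\<mu> \<in> borel_prob_measures"
  shows "prob_space \<mu>" "sets \<mu> = sets borel" "space \<mu> = UNIV"
  using assms sets_eq_imp_space_eq[of \<mu> borel] by (auto simp: borel_prob_measures_def)

lemma borel_measurable_borel_prob:
  assumes "\<mu> \<in> borel_prob_measures" "f \<in> borel_measurable borel"
  shows "f \<in> borel_measurable \<mu>"
  using assms(2) by (simp add: measurable_cong_sets[OF borel_prob_measuresD(2)[OF assms(1)] refl])

lemma continuous_bounded_compact:
  fixes f :: "'a::topological_space \<Rightarrow> real"
  assumes "compact (UNIV :: 'a set)" "continuous_on UNIV f"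
  obtains B where "B > 0" "\<And>x. \<bar>f x\<bar> \<le> B"
  using compact_imp_bounded[OF compact_continuous_image[OF assms(2,1)]] by (auto simp: bounded_pos)

lemma continuous_integrable_compact:
  fixes f :: "'a::topological_space \<Rightarrow> real"
  assumes "compact (UNIV :: 'a set)" "continuous_on UNIV f" "\<mu> \<in> borel_prob_measures"
  shows "integrable \<mu> f"
proof -
  interpret prob_space \<mu> by (rule borel_prob_measuresD[OF assms(3)])
  obtain B where "\<And>x. \<bar>f x\<bar> \<le> B" using continuous_bounded_compact[OF assms(1,2)] by metis
  then show ?thesis
    using borel_measurable_borel_prob[OF assms(3) borel_measurable_continuous_onI[OF assms(2)]]
    by (intro integrable_const_bound[where B = B]) auto
qed

text \<open>Closed sets generate the Borel sets, and their indicators are decreasing limits of continuous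
  functions.\<close>

lemma borel_prob_measure_eqI_integral:
  fixes \<mu> \<nu> :: "'a::metric_space measure"
  assumes \<mu>: "\<mu> \<in> borel_prob_measures" and \<nu>: "\<nu> \<in> borel_prob_measures"
    and eq: "\<And>f :: 'a \<Rightarrow> real. continuous_on UNIV f \<Longrightarrow> (\<integral>x. f x \<partial>\<mu>) = (\<integral>x. f x \<partial>\<nu>)"
  shows "\<mu> = \<nu>"
proof (rule measure_eqI_generator_eq[where E = "Collect closed" and \<Omega> = UNIV and A = "\<lambda>_. UNIV"])
  show "sets \<mu> = sigma_sets UNIV (Collect closed)" "sets \<nu> = sigma_sets UNIV (Collect closed)"
    using borel_prob_measuresD(2)[OF \<mu>] borel_prob_measuresD(2)[OF \<nu>] by (simp_all add: borel_eq_closed)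
  show "emeasure \<mu> UNIV \<noteq> \<infinity>"
    using prob_space.emeasure_space_1[of \<mu>] borel_prob_measuresD[OF \<mu>] by simp
  fix C :: "'a set" assume "C \<in> Collect closed"
  then have C: "closed C" by simp
  define g where "g = (\<lambda>k::nat. \<lambda>x. max 0 (1 - real k * infdist x C))"
  have lim: "(\<lambda>k. \<integral>x. g k x \<partial>\<rho>) \<longlonglongrightarrow> measure \<rho> C" if \<rho>: "\<rho> \<in> borel_prob_measures" and "C \<noteq> {}" for \<rho>
  proof -
    interpret prob_space \<rho> by (rule borel_prob_measuresD[OF \<rho>])
    have C_sets: "C \<in> sets \<rho>" using C borel_prob_measuresD(2)[OF \<rho>] by simp
    have pointwise: "(\<lambda>k. g k x) \<longlonglongrightarrow> indicator C x" for x
    proof (cases "x \<in> C")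
      case True
      then show ?thesis by (simp add: g_def)
    next
      case False
      then have "0 < infdist x C"
        using in_closed_iff_infdist_zero[OF C that(2), of x] infdist_nonneg[of x C] by linarith
      then obtain K :: nat where K: "1 / infdist x C < real K"
        using reals_Archimedean2 by blast
      show ?thesis
      proof (rule tendsto_eventually)
        show "\<forall>\<^sub>F k in sequentially. g k x = indicator C x"
          using eventually_ge_at_top[of K]
        proof eventually_elim
          case (elim k)
          then have "1 / infdist x C \<le> real k" using K by linarith
          then show ?case using \<open>0 < infdist x C\<close> False by (simp add: g_def field_simps)
        qed
      qed
    qed
    have "(\<lambda>k. \<integral>x. g k x \<partial>\<rho>) \<longlonglongrightarrow> (\<integral>x. indicator C x \<partial>\<rho>)"
    proof (rule integral_dominated_convergence[where w = "\<lambda>_. 1"])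
      show "g k \<in> borel_measurable \<rho>" for k
        unfolding g_def
        by (intro borel_measurable_borel_prob[OF \<rho>] borel_measurable_continuous_onI continuous_intros)
      show "AE x in \<rho>. norm (g k x) \<le> 1" for k
        by (simp add: g_def infdist_nonneg)
    qed (use C_sets pointwise in auto)
    then show ?thesis using C_sets by simp
  qed
  show "emeasure \<mu> C = emeasure \<nu> C"
  proof (cases "C = {}")
    case False
    have "(\<integral>x. g k x \<partial>\<mu>) = (\<integral>x. g k x \<partial>\<nu>)" for k
      unfolding g_def by (intro eq continuous_intros)
    then have "measure \<mu> C = measure \<nu> C"
      using lim[OF \<mu> False] lim[OF \<nu> False] by (simp add: LIMSEQ_unique)
    then show ?thesis
      using borel_prob_measuresD(1)[OF \<mu>] borel_prob_measuresD(1)[OF \<nu>]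
      by (simp add: finite_measure.emeasure_eq_measure prob_space.finite_measure)
  qed simp
qed (auto simp: Int_stable_def)

text \<open>Weak* compactness of the space of Borel probability measures, phrased with filters. The integrals
  against \<open>m i\<close> are points of a product of compact intervals, one for each function; Tychonoff's theorem gives a
  cluster point, which inherits linearity and positivity and so comes from a measure.\<close>

lemma borel_prob_measures_cluster:
  fixes m :: "'i \<Rightarrow> 'a::metric_space measure"
  assumes compact: "compact (UNIV :: 'a set)" and F: "F \<noteq> bot"
    and m: "\<And>i. m i \<in> borel_prob_measures"
  obtains G \<mu> where "G \<le> F" "G \<noteq> bot" "limitin weak_star m \<mu> G"
proof -
  \<comment> \<open>Off the continuous functions the value \<open>0\<close> keeps \<open>I i\<close> inside the box \<open>K\<close>.\<close>
  define I where "I = (\<lambda>i (f :: 'a \<Rightarrow> real). if continuous_on UNIV f then (\<integral>x. f x \<partial>m i) else 0)"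
  define b where "b = (\<lambda>f :: 'a \<Rightarrow> real. SUP x. \<bar>f x\<bar>)"
  define K where "K = (\<Pi>\<^sub>E f\<in>UNIV. {- \<bar>b f\<bar> .. \<bar>b f\<bar>})"
  have "I i f \<in> {- \<bar>b f\<bar> .. \<bar>b f\<bar>}" for i f
  proof (cases "continuous_on UNIV f")
    case True
    interpret prob_space "m i" by (rule borel_prob_measuresD[OF m])
    obtain B where "\<And>x. \<bar>f x\<bar> \<le> B" using continuous_bounded_compact[OF compact True] by metis
    then have "\<bar>f x\<bar> \<le> \<bar>b f\<bar>" for x
      unfolding b_def by (intro order.trans[OF cSUP_upper abs_ge_self]) (auto intro!: bdd_aboveI[where M = B])
    then have "- \<bar>b f\<bar> \<le> f x" "f x \<le> \<bar>b f\<bar>" for x by (metis abs_le_iff minus_le_iff)+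
    then have "(\<integral>x. f x \<partial>m i) \<le> \<bar>b f\<bar>" "- \<bar>b f\<bar> \<le> (\<integral>x. f x \<partial>m i)"
      using continuous_integrable_compact[OF compact True m]
      by (intro integral_le_const integral_ge_const; simp)+
    then show ?thesis using True by (simp add: I_def)
  qed (simp add: I_def)
  then have "eventually (\<lambda>J. J \<in> K) (filtermap I F)"
    by (simp add: eventually_filtermap K_def PiE_UNIV_domain Pi_iff)
  moreover have "compact K"
  proof -
    have "compactin (product_topology (\<lambda>_. euclideanreal) UNIV) K"
      by (simp add: K_def compactin_PiE)
    then show ?thesis by (simp add: euclidean_product_topology)
  qed
  moreover have "filtermap I F \<noteq> bot" using F by (simp add: filtermap_bot_iff)
  ultimately obtain L where L: "inf (nhds L) (filtermap I F) \<noteq> bot"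
    unfolding compact_filter by blast
  define G where "G = inf F (filtercomap I (nhds L))"
  have G_bot: "G \<noteq> bot"
  proof
    assume "G = bot"
    then have "eventually (\<lambda>_. False) (inf F (filtercomap I (nhds L)))" by (simp add: G_def)
    then obtain P Q where "eventually P F" "eventually Q (nhds L)" "\<And>x. P x \<Longrightarrow> Q (I x) \<Longrightarrow> False"
      unfolding eventually_inf eventually_filtercomap by blast
    then have "eventually Q (nhds L)" "eventually (\<lambda>J. \<not> Q J) (filtermap I F)"
      by (auto simp: eventually_filtermap elim!: eventually_mono)
    then have "eventually (\<lambda>_. False) (inf (nhds L) (filtermap I F))"
      unfolding eventually_inf by blast
    then show False using L by (simp add: eventually_False)
  qed
  have "filterlim I (nhds L) G"
    by (rule filterlim_mono[OF filterlim_filtercomap order.refl]) (simp add: G_def)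
  then have I_lim: "((\<lambda>i. I i f) \<longlongrightarrow> L f) G" for f
    using continuous_on_tendsto_compose[OF continuous_on_product_coordinates[of f], of I L G] by simp
  then have lim: "((\<lambda>i. \<integral>x. f x \<partial>m i) \<longlongrightarrow> L f) G" if "continuous_on UNIV f" for f
    using I_lim[of f] that by (simp add: I_def)
  note integrable = continuous_integrable_compact[OF compact _ m]
  obtain \<mu> where \<mu>: "\<mu> \<in> borel_prob_measures"
    and \<mu>_int: "\<And>f. continuous_on UNIV f \<Longrightarrow> (\<integral>x. f x \<partial>\<mu>) = L f"
  proof (rule riesz_representation_compact[OF compact, of L])
    show "L (\<lambda>x. f x + g x) = L f + L g" if "continuous_on UNIV f" "continuous_on UNIV g" for f g
      using tendsto_unique[OF G_bot lim[of "\<lambda>x. f x + g x"]] tendsto_add[OF lim lim] that integrable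
      by (simp add: continuous_intros)
    show "L (\<lambda>x. c * f x) = c * L f" if "continuous_on UNIV f" for f c
      using tendsto_unique[OF G_bot lim[of "\<lambda>x. c * f x"]] tendsto_mult_left[OF lim] that integrable
      by (simp add: continuous_intros)
    show "0 \<le> L f" if "continuous_on UNIV f" "\<And>x. 0 \<le> f x" for f
      using that by (intro tendsto_lowerbound[OF lim _ G_bot] always_eventually) auto
    have "(\<integral>x. 1 \<partial>m i) = (1::real)" for i
      using prob_space.prob_space[OF borel_prob_measuresD(1)[OF m[of i]]] by simp
    then have "((\<lambda>_. 1) \<longlongrightarrow> L (\<lambda>_. 1)) G"
      using lim[of "\<lambda>_. 1"] by simp
    then show "L (\<lambda>_. 1) = 1"
      using tendsto_const_iff[OF G_bot] by metis
  qed blast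
  have "limitin weak_star m \<mu> G"
    unfolding limitin_weak_star_iff using \<mu> m \<mu>_int lim by simp
  then show thesis using that[of G \<mu>] G_bot by (simp add: G_def)
qed

section \<open>Empirical measures and their accumulation points\<close>

lemma continuous_on_funpow:
  fixes T :: "'a::topological_space \<Rightarrow> 'a"
  assumes "continuous_on UNIV T"
  shows "continuous_on UNIV (T ^^ n)"
proof (induction n)
  case (Suc n)
  then show ?case
    using continuous_on_compose[of UNIV "T ^^ n" T] continuous_on_subset[OF assms] by auto
qed (simp add: continuous_on_id id_def)

lemma continuous_on_birkhoff_average:
  fixes T :: "'a::topological_space \<Rightarrow> 'a"
  assumes "continuous_on UNIV T" "continuous_on UNIV f"
  shows "continuous_on UNIV (\<lambda>x. birkhoff_average T f x n)"
  unfolding birkhoff_average_def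
  by (intro continuous_intros continuous_on_compose2[OF assms(2) continuous_on_funpow[OF assms(1)]]) auto

lemma measurable_orbit:
  "(\<lambda>j. (T ^^ j) x) \<in> measurable (uniform_count_measure {..<n}) (borel :: 'a::topological_space measure)"
  by (simp add: measurable_def space_uniform_count_measure sets_uniform_count_measure)

lemma empirical_measure_in_borel_prob: "empirical_measure T x (Suc n) \<in> borel_prob_measures"
  unfolding empirical_measure_def borel_prob_measures_def
  using prob_space.prob_space_distr[OF prob_space_uniform_count_measure measurable_orbit, of "Suc n" T x]
  by (simp add: lessThan_empty_iff)

lemma integral_empirical_measure:
  fixes T :: "'a::topological_space \<Rightarrow> 'a"
  assumes "continuous_on UNIV f"
  shows "(\<integral>y. f y \<partial>empirical_measure T x n) = birkhoff_average T f x n"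
  unfolding empirical_measure_def birkhoff_average_def
  by (subst integral_distr[OF measurable_orbit borel_measurable_continuous_onI[OF assms]])
    (simp add: integral_uniform_count_measure)

lemma invariant_measures_borel_prob: "\<mu> \<in> invariant_measures T \<Longrightarrow> \<mu> \<in> borel_prob_measures"
  by (simp add: invariant_measures_def)

lemma measurable_borel_prob_self:
  assumes "\<mu> \<in> borel_prob_measures" "T \<in> measurable borel borel"
  shows "T \<in> measurable \<mu> borel"
  using assms(2) by (simp add: measurable_cong_sets[OF borel_prob_measuresD(2)[OF assms(1)] refl])

lemma invariant_measuresI_integral:
  fixes T :: "'a::metric_space \<Rightarrow> 'a"
  assumes T: "continuous_on UNIV T" and \<mu>: "\<mu> \<in> borel_prob_measures"
    and inv: "\<And>f :: 'a \<Rightarrow> real. continuous_on UNIV f \<Longrightarrow> (\<integral>x. f (T x) \<partial>\<mu>) = (\<integral>x. f x \<partial>\<mu>)"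
  shows "\<mu> \<in> invariant_measures T"
proof -
  have meas: "T \<in> measurable \<mu> borel"
    by (intro measurable_borel_prob_self[OF \<mu>] borel_measurable_continuous_onI T)
  have "distr \<mu> borel T = \<mu>"
  proof (rule borel_prob_measure_eqI_integral[OF _ \<mu>])
    show "distr \<mu> borel T \<in> borel_prob_measures"
      using prob_space.prob_space_distr[OF borel_prob_measuresD(1)[OF \<mu>] meas]
      by (simp add: borel_prob_measures_def)
    show "(\<integral>x. f x \<partial>distr \<mu> borel T) = (\<integral>x. f x \<partial>\<mu>)" if "continuous_on UNIV f" for f :: "'a \<Rightarrow> real"
      using inv[OF that] integral_distr[OF meas borel_measurable_continuous_onI[OF that]] by simp
  qed
  then show ?thesis using \<mu> by (simp add: invariant_measures_def)
qed

lemma integral_invariant: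
  fixes f :: "'a::topological_space \<Rightarrow> real"
  assumes \<mu>: "\<mu> \<in> invariant_measures T" and T: "T \<in> measurable borel borel"
    and f: "integrable \<mu> f"
  shows "integrable \<mu> (\<lambda>x. f (T x))" "(\<integral>x. f (T x) \<partial>\<mu>) = (\<integral>x. f x \<partial>\<mu>)"
proof -
  have bp: "\<mu> \<in> borel_prob_measures" using \<mu> by (rule invariant_measures_borel_prob)
  have d: "distr \<mu> borel T = \<mu>" using \<mu> by (simp add: invariant_measures_def)
  have T': "T \<in> measurable \<mu> borel" by (rule measurable_borel_prob_self[OF bp T])
  have f': "f \<in> borel_measurable borel"
    using borel_measurable_integrable[OF f]
    by (simp add: measurable_cong_sets[OF borel_prob_measuresD(2)[OF bp] refl])
  show "integrable \<mu> (\<lambda>x. f (T x))"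
    using integrable_distr_eq[OF T' f'] f d by simp
  show "(\<integral>x. f (T x) \<partial>\<mu>) = (\<integral>x. f x \<partial>\<mu>)"
    using integral_distr[OF T' f'] d by simp
qed

lemma birkhoff_average_shift:
  "birkhoff_average T (\<lambda>y. f (T y)) x n - birkhoff_average T f x n = (f ((T ^^ n) x) - f x) / real n"
proof -
  have "(\<Sum>j<n. f (T ((T ^^ j) x))) - (\<Sum>j<n. f ((T ^^ j) x)) = f ((T ^^ n) x) - f x"
    using sum_lessThan_telescope[of "\<lambda>j. f ((T ^^ j) x)" n] by (simp add: sum_subtractf)
  then show ?thesis
    by (simp add: birkhoff_average_def flip: diff_divide_distrib)
qed

text \<open>The averages of \<open>f\<close> and of \<open>f \<circ> T\<close> along \<open>n\<close> steps differ by a telescoped boundary term of size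
  \<open>O(1 / n)\<close>. A general filter with a reindexing \<open>r\<close> covers both subsequences, as in the definition of
  \<^const>\<open>empirical_limits\<close>, and the cluster filters of the compactness theorem.\<close>

lemma empirical_limit_invariant:
  fixes T :: "'a::metric_space \<Rightarrow> 'a"
  assumes compact: "compact (UNIV :: 'a set)" and T: "continuous_on UNIV T"
    and G: "filterlim r sequentially G" "G \<noteq> bot"
    and lim: "limitin weak_star (\<lambda>i. empirical_measure T x (Suc (r i))) \<mu> G"
  shows "\<mu> \<in> invariant_measures T"
proof (rule invariant_measuresI_integral[OF T])
  show "\<mu> \<in> borel_prob_measures" using lim by (simp add: limitin_weak_star_iff)
  fix f :: "'a \<Rightarrow> real" assume f: "continuous_on UNIV f"
  have fT: "continuous_on UNIV (\<lambda>x. f (T x))"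
    using continuous_on_compose2[OF f T] by simp
  have conv: "((\<lambda>i. birkhoff_average T g x (Suc (r i))) \<longlongrightarrow> (\<integral>y. g y \<partial>\<mu>)) G"
    if "continuous_on UNIV g" for g
    using lim that unfolding limitin_weak_star_iff by (simp add: integral_empirical_measure)
  obtain B where B: "\<And>x. \<bar>f x\<bar> \<le> B" using continuous_bounded_compact[OF compact f] by metis
  have "(\<lambda>n. (f ((T ^^ Suc n) x) - f x) / real (Suc n)) \<longlonglongrightarrow> 0"
  proof (rule Lim_null_comparison)
    show "\<forall>\<^sub>F n in sequentially. norm ((f ((T ^^ Suc n) x) - f x) / real (Suc n)) \<le> 2 * B / real (Suc n)"
    proof (intro always_eventually allI)
      fix n
      have "\<bar>f ((T ^^ Suc n) x) - f x\<bar> \<le> 2 * B"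
        using B[of "(T ^^ Suc n) x"] B[of x] by linarith
      then show "norm ((f ((T ^^ Suc n) x) - f x) / real (Suc n)) \<le> 2 * B / real (Suc n)"
        by (simp add: divide_right_mono)
    qed
    show "(\<lambda>n. 2 * B / real (Suc n)) \<longlonglongrightarrow> 0"
      by (intro LIMSEQ_Suc lim_const_over_n)
  qed
  from filterlim_compose[OF this G(1)]
  have "((\<lambda>i. birkhoff_average T (\<lambda>y. f (T y)) x (Suc (r i)) - birkhoff_average T f x (Suc (r i))) \<longlongrightarrow> 0) G"
    by (simp only: birkhoff_average_shift)
  moreover have "((\<lambda>i. birkhoff_average T (\<lambda>y. f (T y)) x (Suc (r i)) - birkhoff_average T f x (Suc (r i)))
      \<longlongrightarrow> (\<integral>y. f (T y) \<partial>\<mu>) - (\<integral>y. f y \<partial>\<mu>)) G"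
    by (intro tendsto_diff conv f fT)
  ultimately have "(\<integral>y. f (T y) \<partial>\<mu>) - (\<integral>y. f y \<partial>\<mu>) = 0"
    using tendsto_unique[OF G(2)] by blast
  then show "(\<integral>y. f (T y) \<partial>\<mu>) = (\<integral>y. f y \<partial>\<mu>)" by simp
qed

text \<open>If the averages at \<open>x\<close> stayed away from \<open>c\<close> infinitely often, the empirical measures at those times
  would accumulate at an invariant measure that does not integrate \<open>f\<close> to \<open>c\<close>.\<close>

lemma birkhoff_average_tendsto_const:
  fixes T :: "'a::metric_space \<Rightarrow> 'a"
  assumes compact: "compact (UNIV :: 'a set)" and T: "continuous_on UNIV T"
    and f: "continuous_on UNIV f" and const: "\<And>\<mu>. \<mu> \<in> invariant_measures T \<Longrightarrow> (\<integral>x. f x \<partial>\<mu>) = c"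
  shows "(\<lambda>n. birkhoff_average T f x (Suc n)) \<longlonglongrightarrow> c"
proof (rule ccontr)
  assume "\<not> ?thesis"
  then obtain e where e: "e > 0"
    and freq: "\<not> (\<forall>\<^sub>F n in sequentially. \<bar>birkhoff_average T f x (Suc n) - c\<bar> < e)"
    by (auto simp: tendsto_iff dist_real_def)
  define F where "F = inf sequentially (principal {n. e \<le> \<bar>birkhoff_average T f x (Suc n) - c\<bar>})"
  have "F \<noteq> bot"
    using freq by (simp add: F_def trivial_limit_def eventually_inf_principal not_le)
  then obtain G \<mu> where G: "G \<le> F" "G \<noteq> bot"
    and lim: "limitin weak_star (\<lambda>n. empirical_measure T x (Suc n)) \<mu> G"
    using borel_prob_measures_cluster[OF compact, of F "\<lambda>n. empirical_measure T x (Suc n)"]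
      empirical_measure_in_borel_prob by blast
  have "G \<le> sequentially" using G(1) by (simp add: F_def)
  then have "filterlim (\<lambda>n. n) sequentially G" by (simp add: filterlim_def)
  then have "\<mu> \<in> invariant_measures T"
    using empirical_limit_invariant[OF compact T, of "\<lambda>n. n" G x \<mu>] G(2) lim by simp
  then have "((\<lambda>n. birkhoff_average T f x (Suc n)) \<longlongrightarrow> c) G"
    using lim f const unfolding limitin_weak_star_iff by (auto simp: integral_empirical_measure)
  then have "\<forall>\<^sub>F n in G. \<bar>birkhoff_average T f x (Suc n) - c\<bar> < e"
    using e by (auto simp: tendsto_iff dist_real_def)
  moreover have "\<forall>\<^sub>F n in G. e \<le> \<bar>birkhoff_average T f x (Suc n) - c\<bar>"
    using G(1) by (rule filter_leD) (simp add: F_def eventually_inf_principal)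
  ultimately have "\<forall>\<^sub>F n in G. False" by eventually_elim simp
  then show False using G(2) by (simp add: eventually_False)
qed

section \<open>The ergodic theorem\<close>

text \<open>The maximum of \<open>0\<close> and the partial sums \<open>f x + \<dots> + f (T^k x)\<close> for \<open>k < n\<close>, in the recursive form that the
  maximal ergodic argument uses.\<close>

primrec max_birkhoff_sum :: "('a \<Rightarrow> 'a) \<Rightarrow> ('a \<Rightarrow> real) \<Rightarrow> nat \<Rightarrow> 'a \<Rightarrow> real" where
  "max_birkhoff_sum T f 0 x = 0"
| "max_birkhoff_sum T f (Suc n) x = max 0 (f x + max_birkhoff_sum T f n (T x))"

lemma max_birkhoff_sum_nonneg: "0 \<le> max_birkhoff_sum T f n x"
  by (cases n) auto

lemma max_birkhoff_sum_mono_Suc: "max_birkhoff_sum T f n x \<le> max_birkhoff_sum T f (Suc n) x"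
proof (induction n arbitrary: x)
  case (Suc n)
  have "max 0 (f x + max_birkhoff_sum T f n (T x)) \<le> max 0 (f x + max_birkhoff_sum T f (Suc n) (T x))"
    using Suc[of "T x"] by (intro max.mono) auto
  then show ?case by simp
qed (simp add: max_birkhoff_sum_nonneg)

lemma max_birkhoff_sum_mono: "m \<le> n \<Longrightarrow> max_birkhoff_sum T f m x \<le> max_birkhoff_sum T f n x"
  by (rule lift_Suc_mono_le[of "\<lambda>n. max_birkhoff_sum T f n x"]) (rule max_birkhoff_sum_mono_Suc)

lemma sum_orbit_le_max_birkhoff_sum: "(\<Sum>j<n. f ((T ^^ j) x)) \<le> max_birkhoff_sum T f n x"
proof (induction n arbitrary: x)
  case (Suc n)
  have "(\<Sum>j<Suc n. f ((T ^^ j) x)) = f x + (\<Sum>j<n. f ((T ^^ j) (T x)))"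
    unfolding sum.lessThan_Suc_shift by (simp add: funpow_Suc_right del: funpow.simps)
  then show ?case using Suc[of "T x"] by simp
qed simp

text \<open>The set \<open>A\<close> where the maxima \<open>F N\<close> are unbounded is invariant, so it is null or conull. The integral of
  \<open>F (N + 1) - F N \<circ> T\<close> is nonnegative, because \<open>F\<close> increases and \<open>T\<close> preserves the measure. On \<open>A\<close> this
  difference, which is the maximum of \<open>- F N \<circ> T\<close> and \<open>f\<close>, converges to \<open>f\<close> and is dominated by
  the absolute value of \<open>f\<close>. So if \<open>A\<close> were conull, the integral of \<open>f\<close> would be nonnegative.\<close>

lemma ergodic_sums_bounded_above:
  fixes f :: "'a::topological_space \<Rightarrow> real"
  assumes erg: "\<eta> \<in> ergodic_measures T" and T: "T \<in> measurable borel borel"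
    and f: "integrable \<eta> f" and neg: "(\<integral>x. f x \<partial>\<eta>) < 0"
  shows "AE x in \<eta>. \<exists>B. \<forall>n. (\<Sum>j<n. f ((T ^^ j) x)) \<le> B"
proof -
  define F where "F = max_birkhoff_sum T f"
  have inv: "\<eta> \<in> invariant_measures T" using erg by (simp add: ergodic_measures_def)
  then have bp: "\<eta> \<in> borel_prob_measures" by (rule invariant_measures_borel_prob)
  interpret prob_space \<eta> by (rule borel_prob_measuresD[OF bp])
  have sets_eq: "sets \<eta> = sets borel" and space_eq: "space \<eta> = UNIV"
    using borel_prob_measuresD[OF bp] by auto
  have F_int: "integrable \<eta> (F N)" for N
  proof (induction N)
    case (Suc N)
    have "integrable \<eta> (\<lambda>x. max 0 (f x + F N (T x)))"
      using f integral_invariant(1)[OF inv T Suc] by (intro Bochner_Integration.integrable_max) auto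
    then show ?case by (simp add: F_def)
  qed (simp add: F_def)
  have F_meas [measurable]: "F N \<in> borel_measurable borel" for N
    using borel_measurable_integrable[OF F_int, of N] by (simp add: measurable_cong_sets[OF sets_eq refl])
  define A where "A = {x. \<forall>b::nat. \<exists>N. real b < F N x}"
  have A_sets: "A \<in> sets borel" unfolding A_def by measurable
  have A_bound: "\<exists>N. t < F N x" if "x \<in> A" for x t
  proof -
    obtain b :: nat where "t < real b" using reals_Archimedean2 by blast
    moreover obtain N where "real b < F N x" using \<open>x \<in> A\<close> by (auto simp: A_def)
    ultimately have "t < F N x" by simp
    then show ?thesis ..
  qed
  have "T -` A = A"
  proof (intro set_eqI iffI)
    fix x assume "x \<in> T -` A"
    then have x: "T x \<in> A" by simp
    have "\<exists>N. real b < F N x" for b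
    proof -
      obtain N where "real b + \<bar>f x\<bar> < F N (T x)" using A_bound[OF x] by blast
      then have "real b < F (Suc N) x" by (simp add: F_def)
      then show ?thesis ..
    qed
    then show "x \<in> A" by (simp add: A_def)
  next
    fix x assume x: "x \<in> A"
    have "\<exists>N. real b < F N (T x)" for b
    proof -
      obtain N where N: "real b + \<bar>f x\<bar> < F N x" using A_bound[OF x] by blast
      then obtain M where "N = Suc M" by (cases N) (auto simp: F_def)
      then have "real b < F M (T x)" using N by (simp add: F_def)
      then show ?thesis ..
    qed
    then show "x \<in> T -` A" by (simp add: A_def)
  qed
  then have "emeasure \<eta> A = 0 \<or> emeasure \<eta> A = 1"
    using erg A_sets by (auto simp: ergodic_measures_def)
  moreover have "emeasure \<eta> A \<noteq> 1"
  proof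
    assume "emeasure \<eta> A = 1"
    then have AE_A: "AE x in \<eta>. x \<in> A"
      using A_sets sets_eq by (simp add: AE_iff_emeasure_eq_1 Collect_mem_eq space_eq)
    have D_eq: "F (Suc N) x - F N (T x) = max (- F N (T x)) (f x)" for N x
      by (simp add: F_def max_def)
    have "(\<lambda>N. \<integral>x. F (Suc N) x - F N (T x) \<partial>\<eta>) \<longlonglongrightarrow> (\<integral>x. f x \<partial>\<eta>)"
    proof (rule integral_dominated_convergence[where w = "\<lambda>x. \<bar>f x\<bar>"])
      show "f \<in> borel_measurable \<eta>" using f by auto
      show "(\<lambda>x. F (Suc N) x - F N (T x)) \<in> borel_measurable \<eta>" for N
        using F_int integral_invariant(1)[OF inv T F_int] by (intro borel_measurable_diff) auto
      show "integrable \<eta> (\<lambda>x. \<bar>f x\<bar>)" using f by simp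
      show "AE x in \<eta>. norm (F (Suc N) x - F N (T x)) \<le> \<bar>f x\<bar>" for N
      proof (rule AE_I2)
        fix x
        have "0 \<le> F N (T x)" by (simp add: F_def max_birkhoff_sum_nonneg)
        then show "norm (F (Suc N) x - F N (T x)) \<le> \<bar>f x\<bar>" unfolding D_eq by auto
      qed
      show "AE x in \<eta>. (\<lambda>N. F (Suc N) x - F N (T x)) \<longlonglongrightarrow> f x"
        using AE_A
      proof eventually_elim
        case (elim x)
        then have "T x \<in> A" using \<open>T -` A = A\<close> by blast
        then obtain M where M: "\<bar>f x\<bar> < F M (T x)" using A_bound by blast
        show ?case
        proof (rule tendsto_eventually)
          show "\<forall>\<^sub>F N in sequentially. F (Suc N) x - F N (T x) = f x"
            using eventually_ge_at_top[of M]
          proof eventually_elim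
            case (elim N)
            then have "F M (T x) \<le> F N (T x)" unfolding F_def by (rule max_birkhoff_sum_mono)
            then show ?case using M unfolding D_eq by auto
          qed
        qed
      qed
    qed
    moreover have "0 \<le> (\<integral>x. F (Suc N) x - F N (T x) \<partial>\<eta>)" for N
    proof -
      have "(\<integral>x. F N x \<partial>\<eta>) \<le> (\<integral>x. F (Suc N) x \<partial>\<eta>)"
        unfolding F_def by (intro integral_mono F_int[unfolded F_def] max_birkhoff_sum_mono_Suc)
      then show ?thesis
        using F_int integral_invariant[OF inv T F_int] by simp
    qed
    ultimately have "0 \<le> (\<integral>x. f x \<partial>\<eta>)"
      by (intro LIMSEQ_le_const) auto
    then show False using neg by simp
  qed
  ultimately have "AE x in \<eta>. x \<notin> A"
    using A_sets sets_eq by (intro AE_not_in) (simp add: null_sets_def)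
  then show ?thesis
  proof eventually_elim
    case (elim x)
    then obtain b :: nat where "\<And>N. F N x \<le> real b" by (auto simp: A_def not_less)
    then show ?case
      using sum_orbit_le_max_birkhoff_sum[of f T x] unfolding F_def by (metis order.trans)
  qed
qed

text \<open>Subtracting slightly more than the mean makes the integral negative; a bounded sum disappears
  after division by \<open>n\<close>.\<close>

lemma ergodic_average_eventually_less:
  fixes f :: "'a::topological_space \<Rightarrow> real"
  assumes erg: "\<eta> \<in> ergodic_measures T" and T: "T \<in> measurable borel borel"
    and f: "integrable \<eta> f" and e: "0 < e"
  shows "AE x in \<eta>. \<forall>\<^sub>F n in sequentially. birkhoff_average T f x n < (\<integral>x. f x \<partial>\<eta>) + e"
proof -
  interpret prob_space \<eta>
    using erg by (auto simp: ergodic_measures_def invariant_measures_def borel_prob_measures_def)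
  define c where "c = (\<integral>x. f x \<partial>\<eta>) + e / 2"
  have "(\<integral>x. f x - c \<partial>\<eta>) < 0"
    using f e prob_space by (simp add: c_def)
  then have "AE x in \<eta>. \<exists>B. \<forall>n. (\<Sum>j<n. f ((T ^^ j) x) - c) \<le> B"
    using f by (intro ergodic_sums_bounded_above[OF erg T]) auto
  then show ?thesis
  proof eventually_elim
    case (elim x)
    then obtain B where B: "\<And>n. (\<Sum>j<n. f ((T ^^ j) x)) - real n * c \<le> B"
      by (auto simp: sum_subtractf)
    obtain N :: nat where N: "2 * B / e < real N" using reals_Archimedean2 by blast
    show ?case
      using eventually_ge_at_top[of "Suc N"]
    proof eventually_elim
      case (elim n)
      then have n: "2 * B / e < real n" "0 < real n" using N by auto
      then have "B < real n * (e / 2)" using e by (simp add: field_simps)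
      then have "(\<Sum>j<n. f ((T ^^ j) x)) < real n * (c + e / 2)"
        using B[of n] by (simp add: algebra_simps)
      then show ?case
        using n(2) by (simp add: birkhoff_average_def c_def field_simps)
    qed
  qed
qed

text \<open>Birkhoff's theorem for ergodic measures: the one-sided bound is applied to \<open>f\<close> and to \<open>- f\<close>.\<close>

theorem birkhoff_ergodic:
  fixes f :: "'a::topological_space \<Rightarrow> real"
  assumes erg: "\<eta> \<in> ergodic_measures T" and T: "T \<in> measurable borel borel"
    and f: "integrable \<eta> f"
  shows "AE x in \<eta>. (\<lambda>n. birkhoff_average T f x n) \<longlonglongrightarrow> (\<integral>x. f x \<partial>\<eta>)"
proof -
  define c where "c = (\<integral>x. f x \<partial>\<eta>)"
  have "AE x in \<eta>. \<forall>k::nat. \<forall>\<^sub>F n in sequentially. birkhoff_average T f x n < c + 1 / real (Suc k)"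
    unfolding c_def AE_all_countable
    by (intro allI ergodic_average_eventually_less[OF erg T f]) simp
  moreover have "AE x in \<eta>. \<forall>k::nat. \<forall>\<^sub>F n in sequentially.
      birkhoff_average T (\<lambda>x. - f x) x n < - c + 1 / real (Suc k)"
    unfolding AE_all_countable
    using ergodic_average_eventually_less[OF erg T, of "\<lambda>x. - f x"] f by (simp add: c_def)
  ultimately show ?thesis
  proof eventually_elim
    case (elim x)
    show ?case
      unfolding tendsto_iff
    proof (intro allI impI)
      fix e :: real assume "0 < e"
      then obtain k where k: "1 / real (Suc k) < e" using nat_approx_posE by blast
      show "\<forall>\<^sub>F n in sequentially. dist (birkhoff_average T f x n) (\<integral>x. f x \<partial>\<eta>) < e"
        using elim(1)[rule_format, of k] elim(2)[rule_format, of k]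
      proof eventually_elim
        case (elim n)
        have "birkhoff_average T (\<lambda>x. - f x) x n = - birkhoff_average T f x n"
          by (simp add: birkhoff_average_def sum_negf)
        then show ?case using elim k by (simp add: dist_real_def c_def abs_less_iff)
      qed
    qed
  qed
qed

section \<open>Orbit segments imitating an invariant measure\<close>

text \<open>Integrating this function detects whether a measure charges the ball, which makes that
  property visible to the weak* topology.\<close>

definition bump :: "'a::metric_space \<Rightarrow> real \<Rightarrow> 'a \<Rightarrow> real" where
  "bump w r x = max 0 (r - dist w x)"

lemma continuous_on_bump: "continuous_on UNIV (bump w r)"
  unfolding bump_def by (intro continuous_intros)

lemma integral_bump_pos_iff:
  fixes w :: "'a::metric_space"
  assumes compact: "compact (UNIV :: 'a set)" and \<mu>: "\<mu> \<in> borel_prob_measures"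
  shows "0 < (\<integral>x. bump w r x \<partial>\<mu>) \<longleftrightarrow> 0 < emeasure \<mu> (ball w r)"
proof -
  have int: "integrable \<mu> (bump w r)"
    by (rule continuous_integrable_compact[OF compact continuous_on_bump \<mu>])
  have nonneg: "AE x in \<mu>. 0 \<le> bump w r x" by (simp add: bump_def)
  have ball: "ball w r \<in> sets \<mu>" using borel_prob_measuresD(2)[OF \<mu>] by simp
  have "(\<integral>x. bump w r x \<partial>\<mu>) = 0 \<longleftrightarrow> (AE x in \<mu>. bump w r x = 0)"
    by (rule integral_nonneg_eq_0_iff_AE[OF int nonneg])
  also have "\<dots> \<longleftrightarrow> (AE x in \<mu>. x \<notin> ball w r)"
    by (intro arg_cong[where f = "almost_everywhere \<mu>"] ext) (auto simp: bump_def)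
  also have "\<dots> \<longleftrightarrow> emeasure \<mu> (ball w r) = 0"
    using AE_iff_null_sets[OF ball] ball by (simp add: null_sets_def)
  finally show ?thesis
    using integral_nonneg_AE[OF nonneg] by (simp add: less_le zero_less_iff_neq_zero)
qed

lemma measure_center_open_pos:
  assumes "measure_center T = UNIV" "open U" "U \<noteq> {}"
  obtains \<mu> where "\<mu> \<in> invariant_measures T" "0 < emeasure \<mu> U"
proof -
  have "U \<inter> (\<Union>\<mu>\<in>invariant_measures T. measure_support \<mu>) \<noteq> {}"
    using open_Int_closure_eq_empty[OF assms(2)] assms(1,3) unfolding measure_center_def by (metis inf_top_right)
  then show thesis using that assms(2) by (auto simp: measure_support_def)
qed

text \<open>The combination is formed at the level of integrals and then represented by a measure, which
  yields the identity for the integrals together with the measure.\<close>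

lemma invariant_convex_combination:
  fixes T :: "'a::metric_space \<Rightarrow> 'a"
  assumes compact: "compact (UNIV :: 'a set)" and T: "continuous_on UNIV T"
    and \<mu>: "\<mu> \<in> invariant_measures T" and \<nu>: "\<nu> \<in> invariant_measures T"
    and t: "0 \<le> t" "t \<le> 1"
  obtains \<xi> where "\<xi> \<in> invariant_measures T"
    and "\<And>f :: 'a \<Rightarrow> real. continuous_on UNIV f \<Longrightarrow> (\<integral>x. f x \<partial>\<xi>) = (1 - t) * (\<integral>x. f x \<partial>\<nu>) + t * (\<integral>x. f x \<partial>\<mu>)"
proof -
  note bp = \<mu>[THEN invariant_measures_borel_prob] \<nu>[THEN invariant_measures_borel_prob]
  have int: "integrable \<mu> f" "integrable \<nu> f" if "continuous_on UNIV f" for f :: "'a \<Rightarrow> real"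
    using continuous_integrable_compact[OF compact that] bp by auto
  obtain \<xi> where \<xi>: "\<xi> \<in> borel_prob_measures"
    and \<xi>_int: "\<And>f :: 'a \<Rightarrow> real. continuous_on UNIV f \<Longrightarrow> (\<integral>x. f x \<partial>\<xi>) = (1 - t) * (\<integral>x. f x \<partial>\<nu>) + t * (\<integral>x. f x \<partial>\<mu>)"
  proof (rule riesz_representation_compact[OF compact,
        of "\<lambda>f :: 'a \<Rightarrow> real. (1 - t) * (\<integral>x. f x \<partial>\<nu>) + t * (\<integral>x. f x \<partial>\<mu>)"])
    show "0 \<le> (1 - t) * (\<integral>x. f x \<partial>\<nu>) + t * (\<integral>x. f x \<partial>\<mu>)" if "\<And>x. 0 \<le> f x" for f :: "'a \<Rightarrow> real"
      using that t by (intro add_nonneg_nonneg mult_nonneg_nonneg Bochner_Integration.integral_nonneg) auto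
    show "(1 - t) * (\<integral>x. 1 \<partial>\<nu>) + t * (\<integral>x. 1 \<partial>\<mu>) = (1::real)"
      using bp[THEN borel_prob_measuresD(1), THEN prob_space.prob_space] by simp
  qed (auto simp: int algebra_simps)
  have T': "T \<in> measurable borel borel" using T by (rule borel_measurable_continuous_onI)
  have "\<xi> \<in> invariant_measures T"
  proof (rule invariant_measuresI_integral[OF T \<xi>])
    fix f :: "'a \<Rightarrow> real" assume f: "continuous_on UNIV f"
    have fT: "continuous_on UNIV (\<lambda>x. f (T x))" using continuous_on_compose2[OF f T] by simp
    show "(\<integral>x. f (T x) \<partial>\<xi>) = (\<integral>x. f x \<partial>\<xi>)"
      using integral_invariant(2)[OF \<mu> T' int(1)[OF f]] integral_invariant(2)[OF \<nu> T' int(2)[OF f]]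
      by (simp add: \<xi>_int f fT)
  qed
  then show thesis using that \<xi>_int by blast
qed

lemma openin_weak_star_finite:
  fixes a :: "('a::topological_space \<Rightarrow> real) \<Rightarrow> real"
  assumes "finite \<Phi>" "\<And>f. f \<in> \<Phi> \<Longrightarrow> continuous_on UNIV f"
  shows "openin weak_star {\<eta> \<in> borel_prob_measures. \<forall>f\<in>\<Phi>. \<bar>(\<integral>x. f x \<partial>\<eta>) - a f\<bar> < e}"
  using assms
proof (induction \<Phi>)
  case empty
  then show ?case using openin_topspace[of weak_star] by (simp add: topspace_weak_star)
next
  case (insert g \<Phi>)
  have "openin weak_star {\<eta> \<in> borel_prob_measures. (\<integral>x. g x \<partial>\<eta>) \<in> ball (a g) e}"
    unfolding weak_star_def using insert.prems by (intro topology_generated_by_Basis) blast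
  moreover have "{\<eta> \<in> borel_prob_measures. \<forall>f\<in>insert g \<Phi>. \<bar>(\<integral>x. f x \<partial>\<eta>) - a f\<bar> < e}
      = {\<eta> \<in> borel_prob_measures. (\<integral>x. g x \<partial>\<eta>) \<in> ball (a g) e}
        \<inter> {\<eta> \<in> borel_prob_measures. \<forall>f\<in>\<Phi>. \<bar>(\<integral>x. f x \<partial>\<eta>) - a f\<bar> < e}"
    by (auto simp: dist_real_def abs_minus_commute)
  ultimately show ?case using insert by (simp add: openin_Int)
qed

lemma ergodic_approximation:
  fixes T :: "'a::topological_space \<Rightarrow> 'a" and \<Phi> :: "('a \<Rightarrow> real) set"
  assumes dense: "subtopology weak_star (invariant_measures T) closure_of ergodic_measures T
           = invariant_measures T"
    and \<xi>: "\<xi> \<in> invariant_measures T" and \<Phi>: "finite \<Phi>" "\<And>f. f \<in> \<Phi> \<Longrightarrow> continuous_on UNIV f"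
    and e: "0 < e"
  obtains \<eta> where "\<eta> \<in> ergodic_measures T" "\<And>f. f \<in> \<Phi> \<Longrightarrow> \<bar>(\<integral>x. f x \<partial>\<eta>) - (\<integral>x. f x \<partial>\<xi>)\<bar> < e"
proof -
  define W where "W = {\<eta> \<in> borel_prob_measures. \<forall>f\<in>\<Phi>. \<bar>(\<integral>x. f x \<partial>\<eta>) - (\<integral>x. f x \<partial>\<xi>)\<bar> < e}"
  have "openin weak_star W" unfolding W_def by (rule openin_weak_star_finite[OF \<Phi>])
  then have "openin (subtopology weak_star (invariant_measures T)) (W \<inter> invariant_measures T)"
    by (auto simp: openin_subtopology)
  moreover have "\<xi> \<in> W \<inter> invariant_measures T"
    using \<xi> e by (simp add: W_def invariant_measures_borel_prob)
  moreover have "\<xi> \<in> subtopology weak_star (invariant_measures T) closure_of ergodic_measures T"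
    using \<xi> dense by simp
  ultimately obtain \<eta> where "\<eta> \<in> ergodic_measures T" "\<eta> \<in> W"
    unfolding in_closure_of by blast
  then show thesis using that by (auto simp: W_def)
qed

text \<open>The heart of the argument: the passage from \<open>\<nu>\<close> to the perturbation \<open>\<xi>\<close> that charges \<open>W\<close>, to the
  ergodic \<open>\<eta>\<close>, to an \<open>\<eta>\<close>-generic point of \<open>W\<close>. The error \<open>e\<close> is spent as \<open>e / 2\<close> on \<open>\<xi>\<close> and \<open>e / 4\<close>
  on each of the other two steps.\<close>

lemma orbit_average_approximation:
  fixes T :: "'a::metric_space \<Rightarrow> 'a" and \<Phi> :: "('a \<Rightarrow> real) set"
  assumes compact: "compact (UNIV :: 'a set)" and T: "continuous_on UNIV T"
    and center: "measure_center T = UNIV"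
    and dense: "subtopology weak_star (invariant_measures T) closure_of ergodic_measures T
           = invariant_measures T"
    and \<nu>: "\<nu> \<in> invariant_measures T"
    and \<Phi>: "finite \<Phi>" "\<And>f. f \<in> \<Phi> \<Longrightarrow> continuous_on UNIV f"
    and e: "0 < e" and W: "open W" "W \<noteq> {}"
  obtains x n where "x \<in> W" "N \<le> n" "\<And>f. f \<in> \<Phi> \<Longrightarrow> \<bar>birkhoff_average T f x n - (\<integral>y. f y \<partial>\<nu>)\<bar> < e"
proof -
  obtain w r where r: "0 < r" "ball w r \<subseteq> W"
    using W by (meson openE ex_in_conv)
  obtain \<mu> where \<mu>: "\<mu> \<in> invariant_measures T" and "0 < emeasure \<mu> (ball w r)"
    using measure_center_open_pos[OF center, of "ball w r"] r by auto
  then have \<beta>: "0 < (\<integral>x. bump w r x \<partial>\<mu>)" (is "0 < ?\<beta>")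
    using integral_bump_pos_iff[OF compact invariant_measures_borel_prob[OF \<mu>]] by blast
  have "\<forall>\<^sub>F t in at_right 0. \<forall>f\<in>\<Phi>.
      \<bar>((1 - t) * (\<integral>x. f x \<partial>\<nu>) + t * (\<integral>x. f x \<partial>\<mu>)) - (\<integral>x. f x \<partial>\<nu>)\<bar> < e / 2"
  proof (rule eventually_ball_finite[OF \<Phi>(1)], rule ballI)
    fix f :: "'a \<Rightarrow> real"
    have "((\<lambda>t. (1 - t) * (\<integral>x. f x \<partial>\<nu>) + t * (\<integral>x. f x \<partial>\<mu>))
        \<longlongrightarrow> (1 - 0) * (\<integral>x. f x \<partial>\<nu>) + 0 * (\<integral>x. f x \<partial>\<mu>)) (at_right 0)"
      by (intro tendsto_intros)
    then show "\<forall>\<^sub>F t in at_right 0. \<bar>((1 - t) * (\<integral>x. f x \<partial>\<nu>) + t * (\<integral>x. f x \<partial>\<mu>)) - (\<integral>x. f x \<partial>\<nu>)\<bar> < e / 2"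
      unfolding tendsto_iff using e by (auto simp: dist_real_def dest!: spec[of _ "e / 2"])
  qed
  moreover have "\<forall>\<^sub>F t in at_right 0. 0 < t \<and> t < (1::real)"
    by (intro eventually_conj eventually_at_right_less eventually_at_rightI[of 0 1]) auto
  ultimately have "\<forall>\<^sub>F t in at_right 0. (\<forall>f\<in>\<Phi>.
      \<bar>((1 - t) * (\<integral>x. f x \<partial>\<nu>) + t * (\<integral>x. f x \<partial>\<mu>)) - (\<integral>x. f x \<partial>\<nu>)\<bar> < e / 2) \<and> 0 < t \<and> t < (1::real)"
    by (rule eventually_conj)
  then obtain t :: real where t: "0 < t" "t < 1" and close:
    "\<And>f. f \<in> \<Phi> \<Longrightarrow> \<bar>((1 - t) * (\<integral>x. f x \<partial>\<nu>) + t * (\<integral>x. f x \<partial>\<mu>)) - (\<integral>x. f x \<partial>\<nu>)\<bar> < e / 2"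
    using eventually_happens'[of "at_right (0::real)"] trivial_limit_at_right_real by blast
  obtain \<xi> where \<xi>: "\<xi> \<in> invariant_measures T" and
    \<xi>_int: "\<And>f :: 'a \<Rightarrow> real. continuous_on UNIV f \<Longrightarrow> (\<integral>x. f x \<partial>\<xi>) = (1 - t) * (\<integral>x. f x \<partial>\<nu>) + t * (\<integral>x. f x \<partial>\<mu>)"
    using invariant_convex_combination[OF compact T \<mu> \<nu>, of t] t by auto
  \<comment> \<open>The second bound forces \<open>\<eta>\<close> to integrate the bump positively, that is, to charge the ball.\<close>
  define \<delta> where "\<delta> = min (e / 4) (t * ?\<beta>)"
  have "0 < \<delta>" using e t \<beta> by (simp add: \<delta>_def)
  then obtain \<eta> where erg: "\<eta> \<in> ergodic_measures T"
    and \<eta>: "\<And>f. f \<in> insert (bump w r) \<Phi> \<Longrightarrow> \<bar>(\<integral>x. f x \<partial>\<eta>) - (\<integral>x. f x \<partial>\<xi>)\<bar> < \<delta>"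
    using ergodic_approximation[OF dense \<xi>, of "insert (bump w r) \<Phi>" \<delta>] \<Phi> continuous_on_bump by blast
  have bp: "\<eta> \<in> borel_prob_measures"
    using erg by (simp add: ergodic_measures_def invariant_measures_def)
  have "0 \<le> (\<integral>x. bump w r x \<partial>\<nu>)" by (intro integral_nonneg_AE) (simp add: bump_def)
  then have "t * ?\<beta> \<le> (\<integral>x. bump w r x \<partial>\<xi>)"
    using t by (simp add: \<xi>_int continuous_on_bump)
  then have "0 < (\<integral>x. bump w r x \<partial>\<eta>)"
    using \<eta>[of "bump w r"] by (simp add: \<delta>_def abs_less_iff)
  then have ball_pos: "0 < emeasure \<eta> (ball w r)"
    using integral_bump_pos_iff[OF compact bp] by blast
  have T': "T \<in> measurable borel borel" using T by (rule borel_measurable_continuous_onI)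
  have AE_conv: "AE x in \<eta>. \<forall>f\<in>\<Phi>. (\<lambda>n. birkhoff_average T f x n) \<longlonglongrightarrow> (\<integral>x. f x \<partial>\<eta>)"
    using \<Phi> continuous_integrable_compact[OF compact _ bp]
    by (intro AE_ball_countable[THEN iffD2] ballI birkhoff_ergodic[OF erg T'])
      (auto intro: countable_finite)
  obtain x where x: "x \<in> ball w r"
    and conv: "\<And>f. f \<in> \<Phi> \<Longrightarrow> (\<lambda>n. birkhoff_average T f x n) \<longlonglongrightarrow> (\<integral>x. f x \<partial>\<eta>)"
  proof (rule ccontr)
    assume none: "\<not> thesis"
    have "AE x in \<eta>. x \<notin> ball w r"
      using AE_conv by eventually_elim (use none that in blast)
    then have "ball w r \<in> null_sets \<eta>"
      using borel_prob_measuresD(2)[OF bp] by (subst AE_iff_null_sets) auto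
    then show False using ball_pos by (simp add: null_sets_def)
  qed
  have "\<forall>\<^sub>F n in sequentially. \<forall>f\<in>\<Phi>. \<bar>birkhoff_average T f x n - (\<integral>x. f x \<partial>\<eta>)\<bar> < e / 4"
  proof (rule eventually_ball_finite[OF \<Phi>(1)], rule ballI)
    fix f assume "f \<in> \<Phi>"
    then show "\<forall>\<^sub>F n in sequentially. \<bar>birkhoff_average T f x n - (\<integral>x. f x \<partial>\<eta>)\<bar> < e / 4"
      using tendstoD[OF conv, of f "e / 4"] e by (simp add: dist_real_def)
  qed
  then have "\<forall>\<^sub>F n in sequentially. (\<forall>f\<in>\<Phi>. \<bar>birkhoff_average T f x n - (\<integral>x. f x \<partial>\<eta>)\<bar> < e / 4) \<and> N \<le> n"
    by (intro eventually_conj eventually_ge_at_top)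
  then obtain n where n: "N \<le> n"
    "\<And>f. f \<in> \<Phi> \<Longrightarrow> \<bar>birkhoff_average T f x n - (\<integral>x. f x \<partial>\<eta>)\<bar> < e / 4"
    using eventually_happens'[OF sequentially_bot] by blast
  show thesis
  proof (rule that)
    show "x \<in> W" using x r by blast
    show "N \<le> n" by (rule n)
    fix f assume f: "f \<in> \<Phi>"
    have "\<bar>(\<integral>x. f x \<partial>\<eta>) - (\<integral>x. f x \<partial>\<xi>)\<bar> < e / 4"
      using \<eta>[of f] f by (simp add: \<delta>_def)
    moreover have "\<bar>(\<integral>x. f x \<partial>\<xi>) - (\<integral>x. f x \<partial>\<nu>)\<bar> < e / 2"
      using close[OF f] \<xi>_int[OF \<Phi>(2)[OF f]] by simp
    ultimately show "\<bar>birkhoff_average T f x n - (\<integral>y. f y \<partial>\<nu>)\<bar> < e"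
      using n(2)[OF f] by linarith
  qed
qed

section \<open>A countable dense set of observables\<close>

lemma rational_approximation:
  fixes a :: real
  assumes "0 < e"
  shows "\<exists>q\<in>\<rat>. \<bar>q - a\<bar> < e"
proof -
  obtain q where "q \<in> \<rat>" "a - e < q" "q < a + e"
    using Rats_dense_in_real[of "a - e" "a + e"] assms by auto
  then show ?thesis by (intro bexI[of _ q]) auto
qed

lemma continuous_on_Min_finite:
  fixes h :: "'i \<Rightarrow> 'a::topological_space \<Rightarrow> real"
  assumes "finite P" "P \<noteq> {}" "\<And>p. p \<in> P \<Longrightarrow> continuous_on S (h p)"
  shows "continuous_on S (\<lambda>x. Min ((\<lambda>p. h p x) ` P))"
  using assms
proof (induction rule: finite_ne_induct)
  case (insert p P)
  then have "continuous_on S (\<lambda>x. min (h p x) (Min ((\<lambda>p. h p x) ` P)))"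
    by (intro continuous_on_min) auto
  then show ?case using insert by simp
qed simp

text \<open>The dense functions are finite minima of cones \<open>q + L * dist x d\<close> with rational heights and with vertices in a
  countable dense set. For \<open>L\<close> large against the modulus of continuity of \<open>f\<close>, a cone with
  vertex near the graph of \<open>f\<close> stays above \<open>f\<close> up to a small error: near its vertex by uniform
  continuity, and far away because it has risen by more than the oscillation of \<open>f\<close>. The cones at a fine
  net then have a minimum close to \<open>f\<close>.\<close>

lemma countable_uniformly_dense_continuous:
  assumes compact: "compact (UNIV :: 'a::metric_space set)"
  obtains \<Phi> :: "('a::metric_space \<Rightarrow> real) set"
  where "countable \<Phi>" "\<And>g. g \<in> \<Phi> \<Longrightarrow> continuous_on UNIV g"
    and "\<And>f e. continuous_on UNIV f \<Longrightarrow> 0 < e \<Longrightarrow> \<exists>g\<in>\<Phi>. \<forall>x. \<bar>g x - f x\<bar> < e"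
proof -
  have "\<exists>K. finite K \<and> (UNIV :: 'a set) \<subseteq> (\<Union>x\<in>K. ball x (1 / real (Suc n)))" for n
    using compact unfolding compact_eq_totally_bounded by simp
  then obtain net :: "nat \<Rightarrow> 'a set" where net: "\<And>n. finite (net n)"
    "\<And>n. UNIV \<subseteq> (\<Union>x\<in>net n. ball x (1 / real (Suc n)))"
    by metis
  define D where "D = (\<Union>n. net n)"
  have D: "countable D" unfolding D_def using net(1) by (simp add: countable_finite)
  define cone :: "nat \<Rightarrow> ('a \<times> real) set \<Rightarrow> 'a \<Rightarrow> real" where
    "cone = (\<lambda>L P x. Min ((\<lambda>p. snd p + real L * dist x (fst p)) ` P))"
  define \<Phi> where "\<Phi> = (\<lambda>(L, P). cone L P) ` (UNIV \<times> {P. finite P \<and> P \<subseteq> D \<times> \<rat>} \<inter> {(L, P). P \<noteq> {}})"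
  show thesis
  proof (rule that)
    have "countable {P. finite P \<and> P \<subseteq> D \<times> \<rat>}"
      using D countable_rat by (intro countable_Collect_finite_subset countable_SIGMA) auto
    then show "countable \<Phi>"
      unfolding \<Phi>_def by (intro countable_image countable_Int1 countable_SIGMA) auto
    show "continuous_on UNIV g" if "g \<in> \<Phi>" for g
      using that unfolding \<Phi>_def cone_def
      by (auto intro!: continuous_on_Min_finite continuous_intros)
  next
    fix f :: "'a \<Rightarrow> real" and e :: real
    assume f: "continuous_on UNIV f" and e: "0 < e"
    obtain B where B: "0 < B" "\<And>x. \<bar>f x\<bar> \<le> B" using continuous_bounded_compact[OF compact f] by metis
    have "uniformly_continuous_on UNIV f" by (rule compact_uniformly_continuous[OF f compact])
    then obtain \<delta> where \<delta>: "0 < \<delta>" "\<And>x y. dist x y < \<delta> \<Longrightarrow> \<bar>f x - f y\<bar> < e / 4"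
      using e unfolding uniformly_continuous_on_def dist_real_def
      by (metis UNIV_I dist_commute zero_less_divide_iff zero_less_numeral)
    obtain L :: nat where "(2 * B + e) / \<delta> < real L" using reals_Archimedean2 by blast
    then have L: "2 * B + e < real L * \<delta>" using \<delta>(1) by (simp add: field_simps)
    \<comment> \<open>Up to distance \<open>\<rho>\<close> from the vertex, \<open>f\<close> varies and the cone rises by at most \<open>e / 4\<close>.\<close>
    define \<rho> where "\<rho> = min \<delta> (e / (4 * (real L + 1)))"
    have "0 < \<rho>" using \<delta>(1) e by (simp add: \<rho>_def)
    then obtain n where n: "1 / real (Suc n) < \<rho>" using nat_approx_posE by blast
    have "\<exists>q\<in>\<rat>. \<bar>q - f d\<bar> < e / 4" for d
      using e by (intro rational_approximation) simp
    then obtain q where q: "\<And>d. q d \<in> \<rat>" "\<And>d. \<bar>q d - f d\<bar> < e / 4" by metis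
    define P where "P = (\<lambda>d. (d, q d)) ` net n"
    have P: "finite P" "P \<noteq> {}" "P \<subseteq> D \<times> \<rat>"
      using net[of n] q(1) by (auto simp: P_def D_def)
    have "\<bar>cone L P x - f x\<bar> < e" for x
    proof -
      have cone_eq: "cone L P x = Min ((\<lambda>d. q d + real L * dist x d) ` net n)"
        by (simp add: cone_def P_def image_image)
      have fin: "finite ((\<lambda>d. q d + real L * dist x d) ` net n)"
        "(\<lambda>d. q d + real L * dist x d) ` net n \<noteq> {}"
        using P by (auto simp: P_def net(1))
      obtain d where d: "d \<in> net n" "dist d x < 1 / real (Suc n)"
        using net(2)[of n] by (auto simp: subset_eq)
      then have "dist x d < \<rho>" using n by (simp add: dist_commute)
      then have dx: "dist x d < \<delta>" "dist x d \<le> e / (4 * (real L + 1))" by (auto simp: \<rho>_def)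
      have "real L * dist x d \<le> (real L + 1) * (e / (4 * (real L + 1)))"
        using dx(2) by (intro mult_mono) auto
      also have "\<dots> = e / 4" by (simp add: field_simps)
      finally have "q d + real L * dist x d \<le> f x + 3 * e / 4"
        using q(2)[of d] \<delta>(2)[OF dx(1)] by linarith
      then have "cone L P x \<le> f x + 3 * e / 4"
        unfolding cone_eq using d(1) Min_le[OF fin(1)] order.trans by blast
      moreover have "f x - 3 * e / 4 \<le> cone L P x"
        unfolding cone_eq
      proof (rule Min.boundedI[OF fin])
        fix a assume "a \<in> (\<lambda>d. q d + real L * dist x d) ` net n"
        then obtain d where a: "a = q d + real L * dist x d" by blast
        show "f x - 3 * e / 4 \<le> a"
        proof (cases "dist x d < \<delta>")
          case True
          have "0 \<le> real L * dist x d" by simp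
          then show ?thesis using q(2)[of d] \<delta>(2)[OF True] e unfolding a by linarith
        next
          case False
          then have "real L * \<delta> \<le> real L * dist x d" by (simp add: mult_left_mono)
          then show ?thesis using q(2)[of d] B(2)[of x] B(2)[of d] L e unfolding a by linarith
        qed
      qed
      ultimately show ?thesis using e by (simp add: abs_less_iff)
    qed
    moreover have "cone L P \<in> \<Phi>" using P by (auto simp: \<Phi>_def)
    ultimately show "\<exists>g\<in>\<Phi>. \<forall>x. \<bar>g x - f x\<bar> < e" by blast
  qed
qed

lemma integral_diff_le_compact:
  fixes f g :: "'a::metric_space \<Rightarrow> real"
  assumes compact: "compact (UNIV :: 'a set)" and \<mu>: "\<mu> \<in> borel_prob_measures"
    and fg: "continuous_on UNIV f" "continuous_on UNIV g" and le: "\<And>x. \<bar>f x - g x\<bar> \<le> e"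
  shows "\<bar>(\<integral>x. f x \<partial>\<mu>) - (\<integral>x. g x \<partial>\<mu>)\<bar> \<le> e"
proof -
  interpret prob_space \<mu> by (rule borel_prob_measuresD[OF \<mu>])
  note int = continuous_integrable_compact[OF compact _ \<mu>]
  have "\<bar>\<integral>x. f x - g x \<partial>\<mu>\<bar> \<le> (\<integral>x. \<bar>f x - g x\<bar> \<partial>\<mu>)"
    by (rule integral_abs_bound)
  also have "\<dots> \<le> e"
    using le fg int by (intro integral_le_const) auto
  finally show ?thesis using fg int by simp
qed

text \<open>The usual three-epsilon argument; all measures involved have mass \<open>1\<close>, so uniform closeness of functions
  passes to their integrals.\<close>

lemma weak_star_limit_of_dense:
  fixes m :: "nat \<Rightarrow> 'a::metric_space measure" and \<Phi> :: "('a \<Rightarrow> real) set"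
  assumes compact: "compact (UNIV :: 'a set)"
    and m: "\<And>n. m n \<in> borel_prob_measures" and \<nu>: "\<nu> \<in> borel_prob_measures"
    and \<Phi>: "\<And>g. g \<in> \<Phi> \<Longrightarrow> continuous_on UNIV g"
      "\<And>f e. continuous_on UNIV f \<Longrightarrow> 0 < e \<Longrightarrow> \<exists>g\<in>\<Phi>. \<forall>x. \<bar>g x - f x\<bar> < e"
    and conv: "\<And>g. g \<in> \<Phi> \<Longrightarrow> ((\<lambda>n. \<integral>x. g x \<partial>m n) \<longlongrightarrow> (\<integral>x. g x \<partial>\<nu>)) F"
  shows "limitin weak_star m \<nu> F"
  unfolding limitin_weak_star_iff
proof (intro conjI allI impI \<nu> always_eventually m)
  fix f :: "'a \<Rightarrow> real" assume f: "continuous_on UNIV f"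
  show "((\<lambda>n. \<integral>x. f x \<partial>m n) \<longlongrightarrow> (\<integral>x. f x \<partial>\<nu>)) F"
    unfolding tendsto_iff
  proof (intro allI impI)
    fix e :: real assume e: "0 < e"
    then obtain g where g: "g \<in> \<Phi>" "\<And>x. \<bar>g x - f x\<bar> < e / 3" using \<Phi>(2)[OF f, of "e / 3"] by auto
    have close: "\<bar>(\<integral>x. g x \<partial>\<rho>) - (\<integral>x. f x \<partial>\<rho>)\<bar> \<le> e / 3" if "\<rho> \<in> borel_prob_measures" for \<rho>
      using g(2) by (intro integral_diff_le_compact[OF compact that \<Phi>(1)[OF g(1)] f] less_imp_le)
    have "\<forall>\<^sub>F n in F. \<bar>(\<integral>x. g x \<partial>m n) - (\<integral>x. g x \<partial>\<nu>)\<bar> < e / 3"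
      using conv[OF g(1)] e by (auto simp: tendsto_iff dist_real_def dest!: spec[of _ "e / 3"])
    then show "\<forall>\<^sub>F n in F. dist (\<integral>x. f x \<partial>m n) (\<integral>x. f x \<partial>\<nu>) < e"
    proof eventually_elim
      case (elim n)
      then show ?case using close[OF m[of n]] close[OF \<nu>] unfolding dist_real_def by linarith
    qed
  qed
qed

section \<open>Generic points, irregular points and transitivity\<close>

text \<open>A test is a finite set \<open>P\<close> of pairs of an observable and a rational target, together with a number \<open>N\<close>
  that serves both as the lower bound for the time and as the precision. There are countably
  many tests; only those that some invariant measure meets are used, and these give open dense sets.\<close>

theorem generic_empirical_limits:
  fixes T :: "'a::metric_space \<Rightarrow> 'a"
  assumes compact: "compact (UNIV :: 'a set)" and T: "continuous_on UNIV T"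
    and center: "measure_center T = UNIV"
    and dense: "subtopology weak_star (invariant_measures T) closure_of ergodic_measures T
           = invariant_measures T"
  shows "baire_generic {x. empirical_limits T x = invariant_measures T}"
proof -
  obtain \<Phi> :: "('a \<Rightarrow> real) set" where \<Phi>: "countable \<Phi>" "\<And>g. g \<in> \<Phi> \<Longrightarrow> continuous_on UNIV g"
    "\<And>(f :: 'a \<Rightarrow> real) e. continuous_on UNIV f \<Longrightarrow> 0 < e \<Longrightarrow> \<exists>g\<in>\<Phi>. \<forall>x. \<bar>g x - f x\<bar> < e"
    using countable_uniformly_dense_continuous[OF compact] by metis
  define Y where "Y = (\<lambda>(P :: (('a \<Rightarrow> real) \<times> real) set, N::nat). {x. \<exists>n\<ge>N. \<forall>p\<in>P.
      \<bar>birkhoff_average T (fst p) x (Suc n) - snd p\<bar> < 1 / real (Suc N)})"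
  define I where "I = {(P, N). finite P \<and> P \<subseteq> \<Phi> \<times> \<rat> \<and>
      (\<exists>\<nu>\<in>invariant_measures T. \<forall>p\<in>P. \<bar>(\<integral>x. fst p x \<partial>\<nu>) - snd p\<bar> < 1 / real (Suc N))}"
  have "countable ({P. finite P \<and> P \<subseteq> \<Phi> \<times> \<rat>} \<times> (UNIV :: nat set))"
    using \<Phi>(1) countable_rat by (intro countable_SIGMA countable_Collect_finite_subset) auto
  then have I_countable: "countable I"
    by (rule countable_subset[rotated]) (auto simp: I_def)
  have Y_open: "open (Y (P, N))" if "(P, N) \<in> I" for P N
  proof -
    have "open {x. \<forall>p\<in>P. \<bar>birkhoff_average T (fst p) x (Suc n) - snd p\<bar> < 1 / real (Suc N)}" for n
    proof -
      have "open (\<Inter>p\<in>P. {x. \<bar>birkhoff_average T (fst p) x (Suc n) - snd p\<bar> < 1 / real (Suc N)})"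
        using that \<Phi>(2) continuous_on_birkhoff_average[OF T] unfolding I_def
        by (intro open_INT ballI open_Collect_less continuous_intros) auto
      then show ?thesis by (simp add: INTER_eq)
    qed
    moreover have "Y (P, N) = (\<Union>n\<in>{N..}. {x. \<forall>p\<in>P.
        \<bar>birkhoff_average T (fst p) x (Suc n) - snd p\<bar> < 1 / real (Suc N)})"
      by (auto simp: Y_def)
    ultimately show ?thesis by auto
  qed
  have Y_dense: "closure (Y (P, N)) = UNIV" if PN: "(P, N) \<in> I" for P N
  proof -
    obtain \<nu> where \<nu>: "\<nu> \<in> invariant_measures T"
      "\<And>p. p \<in> P \<Longrightarrow> \<bar>(\<integral>x. fst p x \<partial>\<nu>) - snd p\<bar> < 1 / real (Suc N)"
      and P: "P \<subseteq> \<Phi> \<times> \<rat>" "finite P"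
      using PN by (auto simp: I_def)
    have "W \<inter> Y (P, N) \<noteq> {}" if W: "open W" "W \<noteq> {}" for W
    proof -
      \<comment> \<open>The strict inequalities for \<open>\<nu>\<close> leave room: any average within \<open>d\<close> of the integral still passes.\<close>
      define d where "d = Min (insert 1 ((\<lambda>p. 1 / real (Suc N) - \<bar>(\<integral>x. fst p x \<partial>\<nu>) - snd p\<bar>) ` P))"
      have d: "0 < d" "\<And>p. p \<in> P \<Longrightarrow> d \<le> 1 / real (Suc N) - \<bar>(\<integral>x. fst p x \<partial>\<nu>) - snd p\<bar>"
        using P(2) \<nu>(2) unfolding d_def by (auto simp: Min_gr_iff intro!: Min_le)
      obtain x n where x: "x \<in> W" "Suc N \<le> n"
        "\<And>f. f \<in> fst ` P \<Longrightarrow> \<bar>birkhoff_average T f x n - (\<integral>y. f y \<partial>\<nu>)\<bar> < d"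
      proof (rule orbit_average_approximation[OF compact T center dense \<nu>(1) _ _ d(1) W])
        show "finite (fst ` P)" using P(2) by simp
        show "continuous_on UNIV f" if "f \<in> fst ` P" for f using that P(1) \<Phi>(2) by auto
      qed blast
      then obtain k where k: "n = Suc k" "N \<le> k" by (cases n) auto
      have "\<bar>birkhoff_average T (fst p) x (Suc k) - snd p\<bar> < 1 / real (Suc N)" if "p \<in> P" for p
        using x(3)[of "fst p"] d(2)[OF that] that k by auto
      then have "x \<in> Y (P, N)" using k(2) by (auto simp: Y_def)
      then show ?thesis using x(1) by blast
    qed
    from this[of "- closure (Y (P, N))"] show ?thesis
      using closure_subset[of "Y (P, N)"] by blast
  qed
  have "empirical_limits T x = invariant_measures T" if x: "x \<in> (\<Inter>i\<in>I. Y i)" for x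
  proof (intro set_eqI iffI)
    fix \<mu> assume "\<mu> \<in> empirical_limits T x"
    then show "\<mu> \<in> invariant_measures T"
      unfolding empirical_limits_def
      using empirical_limit_invariant[OF compact T filterlim_subseq] sequentially_bot by blast
  next
    fix \<nu> assume \<nu>: "\<nu> \<in> invariant_measures T"
    have "\<Phi> \<noteq> {}" using \<Phi>(3)[of "\<lambda>_. 0" 1] by auto
    then have range: "range (from_nat_into \<Phi>) = \<Phi>" using \<Phi>(1) by (rule range_from_nat_into)
    define \<phi> where "\<phi> = from_nat_into \<Phi>"
    define Q where "Q = (\<lambda>m n. \<forall>k\<le>m. \<bar>birkhoff_average T (\<phi> k) x (Suc n) - (\<integral>y. \<phi> k y \<partial>\<nu>)\<bar>
        < 2 / real (Suc m))"
    have Q_ex: "\<exists>n\<ge>m. Q m n" for m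
    proof -
      have "\<exists>q\<in>\<rat>. \<bar>q - (\<integral>y. \<phi> k y \<partial>\<nu>)\<bar> < 1 / real (Suc m)" for k
        by (rule rational_approximation) simp
      then obtain q where q: "\<And>k. q k \<in> \<rat>" "\<And>k. \<bar>q k - (\<integral>y. \<phi> k y \<partial>\<nu>)\<bar> < 1 / real (Suc m)"
        by metis
      have "((\<lambda>k. (\<phi> k, q k)) ` {..m}, m) \<in> I"
        using q \<nu> range by (auto simp: I_def \<phi>_def abs_minus_commute intro!: bexI[of _ \<nu>])
      then have "x \<in> Y ((\<lambda>k. (\<phi> k, q k)) ` {..m}, m)" using x by blast
      then obtain n where n: "m \<le> n"
        "\<And>k. k \<le> m \<Longrightarrow> \<bar>birkhoff_average T (\<phi> k) x (Suc n) - q k\<bar> < 1 / real (Suc m)"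
        by (auto simp: Y_def)
      have "Q m n"
        unfolding Q_def
      proof (intro allI impI)
        fix k assume "k \<le> m"
        then show "\<bar>birkhoff_average T (\<phi> k) x (Suc n) - (\<integral>y. \<phi> k y \<partial>\<nu>)\<bar> < 2 / real (Suc m)"
          using n(2)[of k] q(2)[of k] by (simp add: abs_less_iff)
      qed
      then show ?thesis using n(1) by blast
    qed
    have Q_mono: "Q m n" if "Q m' n" "m \<le> m'" for m m' n
      unfolding Q_def
    proof (intro allI impI)
      fix k assume "k \<le> m"
      then have "\<bar>birkhoff_average T (\<phi> k) x (Suc n) - (\<integral>y. \<phi> k y \<partial>\<nu>)\<bar> < 2 / real (Suc m')"
        using that by (simp add: Q_def)
      also have "\<dots> \<le> 2 / real (Suc m)" using that(2) by (simp add: frac_le)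
      finally show "\<bar>birkhoff_average T (\<phi> k) x (Suc n) - (\<integral>y. \<phi> k y \<partial>\<nu>)\<bar> < 2 / real (Suc m)" .
    qed
    have "\<exists>r. \<forall>m. Q m (r m) \<and> r m < r (Suc m)"
    proof (rule dependent_nat_choice)
      show "\<exists>n. Q 0 n" using Q_ex by blast
      fix n m assume "Q m n"
      obtain n' where "max (Suc m) (Suc n) \<le> n'" "Q (max (Suc m) (Suc n)) n'" using Q_ex by blast
      then show "\<exists>n'. Q (Suc m) n' \<and> n < n'" using Q_mono by (intro exI[of _ n']) auto
    qed
    then obtain r where r: "\<And>m. Q m (r m)" "strict_mono r" by (auto simp: strict_mono_Suc_iff)
    have "limitin weak_star (\<lambda>k. empirical_measure T x (Suc (r k))) \<nu> sequentially"
    proof (rule weak_star_limit_of_dense[OF compact empirical_measure_in_borel_prob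
          invariant_measures_borel_prob[OF \<nu>] \<Phi>(2,3)])
      fix g assume g: "g \<in> \<Phi>"
      then obtain k where k: "g = \<phi> k" using range by (auto simp: \<phi>_def)
      have "(\<lambda>m. birkhoff_average T (\<phi> k) x (Suc (r m)) - (\<integral>y. \<phi> k y \<partial>\<nu>)) \<longlonglongrightarrow> 0"
      proof (rule Lim_null_comparison)
        show "\<forall>\<^sub>F m in sequentially. norm (birkhoff_average T (\<phi> k) x (Suc (r m)) - (\<integral>y. \<phi> k y \<partial>\<nu>))
            \<le> 2 / real (Suc m)"
          using eventually_ge_at_top[of k]
        proof eventually_elim
          case (elim m)
          then show ?case using r(1)[of m] by (simp add: Q_def less_imp_le)
        qed
        show "(\<lambda>m. 2 / real (Suc m)) \<longlonglongrightarrow> 0" by (intro LIMSEQ_Suc lim_const_over_n)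
      qed
      then show "(\<lambda>m. \<integral>y. g y \<partial>empirical_measure T x (Suc (r m))) \<longlonglongrightarrow> (\<integral>y. g y \<partial>\<nu>)"
        using integral_empirical_measure[OF \<Phi>(2)[OF g]] by (simp add: k LIM_zero_iff)
    qed
    then show "\<nu> \<in> empirical_limits T x" using r(2) by (auto simp: empirical_limits_def)
  qed
  then have "\<Inter>(Y ` I) \<subseteq> {x. empirical_limits T x = invariant_measures T}" by blast
  then show ?thesis
    unfolding baire_generic_def
    using I_countable Y_open Y_dense by (intro exI[of _ "Y ` I"]) auto
qed

text \<open>If the averages of \<open>f\<close> converged at \<open>x\<close>, their limit would be the integral of \<open>f\<close> against every invariant
  measure, as each of them is a limit of empirical measures of \<open>x\<close>; then the averages of \<open>f\<close> would converge at
  every point.\<close>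

lemma empirical_limits_full_completely_irregular:
  fixes T :: "'a::metric_space \<Rightarrow> 'a"
  assumes compact: "compact (UNIV :: 'a set)" and T: "continuous_on UNIV T"
    and full: "empirical_limits T x = invariant_measures T"
  shows "x \<in> completely_irregular T"
  unfolding completely_irregular_def
proof (rule INT_I)
  fix f assume "f \<in> irregular_observables T"
  then have f: "continuous_on UNIV f" and irr: "irregular_set T f \<noteq> {}"
    by (auto simp: irregular_observables_def)
  show "x \<in> irregular_set T f"
  proof (rule ccontr)
    assume "x \<notin> irregular_set T f"
    then obtain c where c: "(\<lambda>n. birkhoff_average T f x (Suc n)) \<longlonglongrightarrow> c"
      by (auto simp: irregular_set_def convergent_def)
    have "(\<integral>y. f y \<partial>\<nu>) = c" if "\<nu> \<in> invariant_measures T" for \<nu>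
    proof -
      have "\<nu> \<in> empirical_limits T x" using that full by simp
      then obtain r where r: "strict_mono r"
        "limitin weak_star (\<lambda>k. empirical_measure T x (Suc (r k))) \<nu> sequentially"
        by (auto simp: empirical_limits_def)
      then have "(\<lambda>k. birkhoff_average T f x (Suc (r k))) \<longlonglongrightarrow> (\<integral>y. f y \<partial>\<nu>)"
        using f by (simp add: limitin_weak_star_iff integral_empirical_measure)
      then show ?thesis
        using LIMSEQ_subseq_LIMSEQ[OF c r(1)] by (simp add: o_def LIMSEQ_unique)
    qed
    then have "convergent (\<lambda>n. birkhoff_average T f y (Suc n))" for y
      using birkhoff_average_tendsto_const[OF compact T f] by (auto simp: convergent_def)
    then show False using irr by (auto simp: irregular_set_def)
  qed
qed

text \<open>If the orbit of \<open>x\<close> avoided \<open>V\<close> from time \<open>1\<close> on, only the term at time \<open>0\<close> would contribute to the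
  average of the bump, making it at most \<open>r / n\<close>. It is instead close to a positive integral for large \<open>n\<close>.\<close>

theorem dense_ergodic_transitive:
  fixes T :: "'a::metric_space \<Rightarrow> 'a"
  assumes compact: "compact (UNIV :: 'a set)" and T: "continuous_on UNIV T"
    and center: "measure_center T = UNIV"
    and dense: "subtopology weak_star (invariant_measures T) closure_of ergodic_measures T
           = invariant_measures T"
  shows "transitive_map T"
  unfolding transitive_map_def
proof (intro allI impI, elim conjE)
  fix U V :: "'a set" assume U: "open U" "U \<noteq> {}" and V: "open V" "V \<noteq> {}"
  obtain v r where r: "0 < r" "ball v r \<subseteq> V"
    using V by (meson openE ex_in_conv)
  obtain \<nu> where \<nu>: "\<nu> \<in> invariant_measures T" and "0 < emeasure \<nu> (ball v r)"
    using measure_center_open_pos[OF center, of "ball v r"] r by auto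
  then have \<beta>: "0 < (\<integral>x. bump v r x \<partial>\<nu>)" (is "0 < ?\<beta>")
    using integral_bump_pos_iff[OF compact invariant_measures_borel_prob[OF \<nu>]] by blast
  obtain N :: nat where N: "2 * r / ?\<beta> < real N" using reals_Archimedean2 by blast
  obtain x n where x: "x \<in> U" "Suc N \<le> n" "\<bar>birkhoff_average T (bump v r) x n - ?\<beta>\<bar> < ?\<beta> / 2"
  proof (rule orbit_average_approximation[OF compact T center dense \<nu> _ _ _ U])
    show "finite {bump v r}" by simp
    show "continuous_on UNIV f" if "f \<in> {bump v r}" for f using that continuous_on_bump by blast
    show "0 < ?\<beta> / 2" using \<beta> by simp
  qed blast
  show "\<exists>n\<ge>1. U \<inter> (T ^^ n) -` V \<noteq> {}"
  proof (rule ccontr)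
    assume "\<not> ?thesis"
    then have out: "(T ^^ j) x \<notin> V" if "1 \<le> j" for j
      using x(1) that by blast
    have zero: "bump v r ((T ^^ j) x) = 0" if "1 \<le> j" for j
    proof -
      have "(T ^^ j) x \<notin> ball v r" using out[OF that] r(2) by blast
      then show ?thesis by (simp add: bump_def)
    qed
    obtain k where k: "n = Suc k" using x(2) by (cases n) auto
    have "(\<Sum>j<n. bump v r ((T ^^ j) x)) = bump v r x"
      unfolding k sum.lessThan_Suc_shift by (simp add: zero del: funpow.simps)
    then have "birkhoff_average T (bump v r) x n = bump v r x / real n"
      by (simp add: birkhoff_average_def)
    also have "\<dots> \<le> r / real n"
      using r(1) by (intro divide_right_mono) (auto simp: bump_def)
    also have "\<dots> < ?\<beta> / 2"
    proof -
      have "2 * r / ?\<beta> < real n" using N x(2) by linarith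
      then show ?thesis using \<beta> k by (simp add: field_simps)
    qed
    finally show False using x(3) by linarith
  qed
qed

lemma baire_generic_mono: "baire_generic A \<Longrightarrow> A \<subseteq> B \<Longrightarrow> baire_generic B"
  unfolding baire_generic_def by (meson order.trans)

theorem theorem2:
  fixes T :: "'a::{metric_space, perfect_space} \<Rightarrow> 'a"
  assumes "compact (UNIV :: 'a set)"
    and "continuous_on UNIV T"
    and "\<not> uniquely_ergodic T"
    and "measure_center T = UNIV"
    and "subtopology weak_star (invariant_measures T) closure_of ergodic_measures T
           = invariant_measures T"
  shows "baire_generic {x. empirical_limits T x = invariant_measures T}
       \<and> baire_generic (completely_irregular T)
       \<and> transitive_map T"
proof (intro conjI)
  show full: "baire_generic {x. empirical_limits T x = invariant_measures T}"
    by (rule generic_empirical_limits[OF assms(1,2,4,5)])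
  show "baire_generic (completely_irregular T)"
    using full
    by (rule baire_generic_mono) (use empirical_limits_full_completely_irregular[OF assms(1,2)] in blast)
  show "transitive_map T"
    by (rule dense_ergodic_transitive[OF assms(1,2,4,5)])
qed

end
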